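(* Let $p=(p_1,\dots,p_n)\in\mathbb{Z}_+^n$ be fixed with at least one $p_k=0$, and let $\mathbf{s}=\{s_{i_1,\dots,i_n}\}$ be a sequence of real numbers such that $s_{i_1,\dots,i_n}=0$ unless $(i_1,\dots,i_n)=(p_1+j,\dots,p_n+j)$ for some $j\ge 0$. Let $\mathfrak{s}=\{\mathfrak{s}_i\}_{i=0}^{2\nu_N-2}$ be the $d_p$-associated sequence of $\mathbf{s}$ and let $\mathcal{N}(\mathfrak{s})=\{\nu_j\}_{j=1}^N\cup\{\mu_j\}_{j=1}^{N-1}$ be its set of normal indices. Then any solution $F_{d_p}$ of the $d_p$-diagonal truncated problem $\mathbf{MP}(\mathbf{s},2\nu_N-2)$ admits the representation $$F_{d_p}(z_1,\dots,z_n)=\frac{1}{\prod_{i=1}^n z_i^{p_i}}\cdot\cfrac{1}{-m_1 z+\cfrac{1}{l_1+\cdots+\cfrac{1}{l_{N-1}+\cfrac{1}{-m_N z+\cfrac{1}{\tau(z_1,\dots,z_n)}}}}},\qquad z=\prod_{i=1}^n z_i,$$ where the parameter $\tau$ satisfies $\dfrac{1}{\tau(z_1,\dots,z_n)}=o\Big(\prod_{i=1}^n z_i\Big)$ as all $z_i\widehat\to\infty$, and the atoms $m_j=m_j(z_1,\dots,z_n)$, $l_j=l_j(z_1,\dots,z_n)$ are given by the determinant formulas and recurrences in the context (with $\ell=2\nu_N-2$).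
   Context: Notation: $z=\prod_{i=1}^n z_i$; $z_i\widehat\to\infty$ means $z_i\to\infty$ inside a sector $\varepsilon<\arg z_i<\pi-\varepsilon$, $\varepsilon>0$. The $d_p$-associated sequence of $\mathbf{s}$ is $\mathfrak{s}_j=\binom{jn+\sum_k p_k}{p_1+j,\dots,p_n+j}s_{p_1+j,\dots,p_n+j}$, $0\le j\le\ell$. The $d_p$-diagonal truncated problem $\mathbf{MP}(\mathbf{s},\ell)$ is to describe the functions $F_{d_p}$ (solutions) such that, as all $z_i\widehat\to\infty$, $$F_{d_p}(z_1,\dots,z_n)=\frac{1}{\prod_i z_i^{p_i}}\Big(-\frac{\mathfrak{s}_0}{z}-\dots-\frac{\mathfrak{s}_\ell}{z^{\ell+1}}+o\Big(\frac1{z^{\ell+1}}\Big)\Big).$$ Normal indices: $D_k=\det(\mathfrak{s}_{i+j})_{i,j=0}^{k-1}$, $D_k^+=\det(\mathfrak{s}_{i+j+1})_{i,j=0}^{k-1}$, $D_0=D_0^+=1$. $\mathcal{N}(\mathfrak{s})$ is the set of $k\ge1$ with $D_k\ne0$; the $\nu_j$ are, in increasing order, those with $D_{\nu_j}\neq0,\ D^+_{\nu_j-1}\ne0$, and the $\mu_j$ those with $D_{\mu_j}\ne0,\ D^+_{\mu_j}\ne0$; one has $0<\nu_1\le\mu_1<\nu_2\le\mu_2<\dots$. Put $\mu_0=0$. Atoms. $T(c_0,\dots,c_r)$ is the $(r+1)\times(r+1)$ upper triangular Toeplitz matrix with entries $c_{k-i}$ ($k\ge i$). Set $\mathfrak{s}^{(1)}=\mathfrak{s}$;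 for each $j$ put $\nu=\nu_j-\mu_{j-1}$, $\mu=\mu_j-\nu_j$, $\ell_j=\ell-2\mu_{j-1}$, and let $D^{(k)}_r$, $D^{(k)+}_r$ be the determinants $D_r,D_r^+$ formed from $\mathfrak{s}^{(k)}$. Given $\{\mathfrak{s}^{(2j-1)}_i\}_{i=0}^{\ell_j}$, $$m_j=\frac{(-1)^{\nu+1}}{D^{(2j-1)}_\nu}\begin{vmatrix}0&\cdots&0&\mathfrak{s}^{(2j-1)}_{\nu-1}&\mathfrak{s}^{(2j-1)}_{\nu}\\ \vdots&&&&\vdots\\ \mathfrak{s}^{(2j-1)}_{\nu-1}&\mathfrak{s}^{(2j-1)}_{\nu}&\cdots&\cdots&\mathfrak{s}^{(2j-1)}_{2\nu-2}\\1&z&\cdots&z^{\nu-2}&z^{\nu-1}\end{vmatrix}=\sum_{i=0}^{\nu-1}m^{(j)}_iz^i ;$$ $\{\mathfrak{s}^{(2j)}_i\}_{i=-1}^{\ell_j-2\nu}$ is defined by $T(m^{(j)}_{\nu-1},\dots,m^{(j)}_0,-\mathfrak{s}^{(2j)}_{-1},\dots,-\mathfrak{s}^{(2j)}_{\ell_j-2\nu})\,T(\mathfrak{s}^{(2j-1)}_{\nu-1},\dots,\mathfrak{s}^{(2j-1)}_{\ell_j})=I_{\ell_j-\nu+2}$; $$l_j=\frac{1}{\mathfrak{s}^{(2j)}_{-1}}=(-1)^{\nu+1}\mathfrak{s}^{(2j-1)}_{\nu-1}\frac{D^{(2j-1)}_\nu}{D^{(2j-1)+}_\nu}\ \text{ if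 }\nu_j=\mu_j,\qquad l_j=\frac{1}{\mathfrak{s}^{(2j)}_{\mu-1}D^{(2j)}_\mu}\begin{vmatrix}\mathfrak{s}^{(2j)}_0&\cdots&\mathfrak{s}^{(2j)}_\mu\\ \vdots&&\vdots\\ \mathfrak{s}^{(2j)}_{\mu-1}&\cdots&\mathfrak{s}^{(2j)}_{2\mu-1}\\1&\cdots&z^\mu\end{vmatrix}\ \text{ if }\nu_j<\mu_j ;$$ with $l_j=\sum_{i=0}^{\mu}l^{(j)}_iz^i$, $\{\mathfrak{s}^{(2j+1)}_i\}_{i=0}^{\ell-2\mu_j}$ is defined by $T(l^{(j)}_{\mu},\dots,l^{(j)}_0,-\mathfrak{s}^{(2j+1)}_0,\dots,-\mathfrak{s}^{(2j+1)}_{\ell-2\mu_j})\,T(\mathfrak{s}^{(2j)}_{\mu-1},\dots,\mathfrak{s}^{(2j)}_{\ell_j-2\nu})=I_{\ell-\mu_j-\nu_j+2}$. *)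

theory Defs
  imports
    "HOL-Analysis.Analysis"
    "HOL-Library.Landau_Symbols"
    "Jordan_Normal_Form.Determinant"
begin

hide_const (open) Determinants.det Finite_Cartesian_Product.mat Finite_Cartesian_Product.vec
  module.smult

no_notation vec_index (infixl "$" 100)

definition sector :: "real \<Rightarrow> complex set" where
  "sector \<epsilon> = {w. \<epsilon> < Arg w \<and> Arg w < pi - \<epsilon>}"

text \<open>All coordinates tend to infinity, each inside the sector of opening \<open>\<epsilon>\<close>. A statement
  about \<open>z\<^sub>i\<close> tending to infinity inside some sector is a statement about this filter for every
  \<open>\<epsilon> > 0\<close>.\<close>

definition at_infinity_sector :: "real \<Rightarrow> (complex ^ 'n) filter" where
  "at_infinity_sector \<epsilon> =
     (INF i. filtercomap (\<lambda>z. z $ i) (inf at_infinity (principal (sector \<epsilon>))))"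

abbreviation zprod :: "complex ^ 'n::finite \<Rightarrow> complex" where
  "zprod z \<equiv> (\<Prod>i\<in>UNIV. z $ i)"

abbreviation zmonom :: "nat ^ 'n::finite \<Rightarrow> complex ^ 'n \<Rightarrow> complex" where
  "zmonom p z \<equiv> (\<Prod>i\<in>UNIV. (z $ i) ^ (p $ i))"

definition diag_index :: "nat ^ 'n \<Rightarrow> nat \<Rightarrow> nat ^ 'n" where
  "diag_index p j = (\<chi> i. p $ i + j)"

definition assoc_seq :: "nat ^ 'n::finite \<Rightarrow> (nat ^ 'n \<Rightarrow> real) \<Rightarrow> nat \<Rightarrow> real" where
  "assoc_seq p s j =
     fact (j * CARD('n) + (\<Sum>k\<in>UNIV. p $ k)) / (\<Prod>k\<in>UNIV. fact (p $ k + j))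
       * s (diag_index p j)"

definition MP_solution ::
    "nat ^ 'n::finite \<Rightarrow> (nat ^ 'n \<Rightarrow> real) \<Rightarrow> nat \<Rightarrow> (complex ^ 'n \<Rightarrow> complex) \<Rightarrow> bool" where
  "MP_solution p s ell F \<longleftrightarrow>
     (\<forall>\<epsilon>>0. (\<lambda>z. F z - 1 / zmonom p z *
                   (- (\<Sum>j\<le>ell. complex_of_real (assoc_seq p s j) / zprod z ^ (j + 1))))
        \<in> o[at_infinity_sector \<epsilon>](\<lambda>z. 1 / zmonom p z * (1 / zprod z ^ (ell + 1))))"

text \<open>Sequences are indexed by integers, because the sequences \<open>\<ss>\<^bsup>(2j)\<^esup>\<close> below start at
  the index \<open>-1\<close>.\<close>

definition hankel :: "(int \<Rightarrow> real) \<Rightarrow> nat \<Rightarrow> real" where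
  "hankel s k = det (mat k k (\<lambda>(i, j). s (int i + int j)))"

definition hankel_plus :: "(int \<Rightarrow> real) \<Rightarrow> nat \<Rightarrow> real" where
  "hankel_plus s k = det (mat k k (\<lambda>(i, j). s (int i + int j + 1)))"

text \<open>For the truncated sequence \<open>s\<^sub>0, \<dots>, s\<^bsub>ell\<^esub>\<close> only those determinants are available whose
  entries have index at most \<open>ell\<close>: \<open>2k - 2\<close> is the largest index in \<open>D\<^sub>k\<close>, and \<open>2k - 1\<close> in
  \<open>D\<^sub>k\<^sup>+\<close>. The determinant of an empty matrix is \<open>1\<close>.\<close>

definition normal_indices :: "(int \<Rightarrow> real) \<Rightarrow> nat \<Rightarrow> nat set" where
  "normal_indices s ell = {k. 1 \<le> k \<and> 2 * int k - 2 \<le> int ell \<and> hankel s k \<noteq> 0}"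

definition nu_indices :: "(int \<Rightarrow> real) \<Rightarrow> nat \<Rightarrow> nat set" where
  "nu_indices s ell = {k \<in> normal_indices s ell. hankel_plus s (k - 1) \<noteq> 0}"

definition mu_indices :: "(int \<Rightarrow> real) \<Rightarrow> nat \<Rightarrow> nat set" where
  "mu_indices s ell = {k \<in> normal_indices s ell. 2 * int k - 1 \<le> int ell \<and> hankel_plus s k \<noteq> 0}"

definition toeplitz :: "real list \<Rightarrow> real mat" where
  "toeplitz c = mat (length c) (length c) (\<lambda>(i, k). if i \<le> k then c ! (k - i) else 0)"

definition m_poly :: "nat \<Rightarrow> (int \<Rightarrow> real) \<Rightarrow> real poly" where
  "m_poly n s = smult ((-1) ^ (n + 1) / hankel s n)
     (det (mat n n (\<lambda>(i, k).
        if i < n - 1 then (if i + k + 1 < n - 1 then 0 else [:s (int i + int k + 1):])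
        else monom 1 k)))"

definition l_poly :: "nat \<Rightarrow> (int \<Rightarrow> real) \<Rightarrow> real poly" where
  "l_poly r s = smult (1 / (s (int r - 1) * hankel s r))
     (det (mat (r + 1) (r + 1) (\<lambda>(i, k).
        if i < r then [:s (int i + int k):] else monom 1 k)))"

text \<open>One step of the recurrence, with \<open>n = \<nu>\<^sub>j - \<mu>\<^bsub>j-1\<^esub>\<close>, \<open>r = \<mu>\<^sub>j - \<nu>\<^sub>j\<close> and
  \<open>L = \<ell>\<^sub>j\<close>; \<open>s\<close>, \<open>s'\<close>, \<open>s''\<close> stand for \<open>\<ss>\<^bsup>(2j-1)\<^esup>\<close>, \<open>\<ss>\<^bsup>(2j)\<^esup>\<close>, \<open>\<ss>\<^bsup>(2j+1)\<^esup>\<close>. The two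
  Toeplitz equations force every quantity that is divided by here to be nonzero.\<close>

definition m_step :: "nat \<Rightarrow> int \<Rightarrow> (int \<Rightarrow> real) \<Rightarrow> real poly \<Rightarrow> (int \<Rightarrow> real) \<Rightarrow> bool" where
  "m_step n L s m s' \<longleftrightarrow>
     m = m_poly n s \<and>
     toeplitz (map (coeff m) (rev [0..<n]) @ map (\<lambda>i. - s' i) [-1..L - 2 * int n])
       * toeplitz (map s [int n - 1..L])
       = 1\<^sub>m (nat (L - int n + 2))"

definition l_step ::
    "nat \<Rightarrow> nat \<Rightarrow> int \<Rightarrow> (int \<Rightarrow> real) \<Rightarrow> (int \<Rightarrow> real) \<Rightarrow> real poly \<Rightarrow> (int \<Rightarrow> real) \<Rightarrow> bool" where
  "l_step n r L s s' l s'' \<longleftrightarrow>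
     (if r = 0
      then l = [:1 / s' (-1):] \<and>
           l = [:(-1) ^ (n + 1) * s (int n - 1) * (hankel s n / hankel_plus s n):]
      else l = l_poly r s') \<and>
     toeplitz (map (coeff l) (rev [0..<r + 1]) @
               map (\<lambda>i. - s'' i) [0..L - 2 * int n - 2 * int r])
       * toeplitz (map s' [int r - 1..L - 2 * int n])
       = 1\<^sub>m (nat (L - 2 * int n - int r + 2))"

definition atoms ::
    "(int \<Rightarrow> real) \<Rightarrow> nat \<Rightarrow> nat \<Rightarrow> (nat \<Rightarrow> nat) \<Rightarrow> (nat \<Rightarrow> nat) \<Rightarrow> (nat \<Rightarrow> int \<Rightarrow> real)
       \<Rightarrow> (nat \<Rightarrow> real poly) \<Rightarrow> (nat \<Rightarrow> real poly) \<Rightarrow> bool" where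
  "atoms s ell N \<nu> \<mu> S m l \<longleftrightarrow>
     (\<forall>i\<in>{0..int ell}. S 1 i = s i) \<and>
     (\<forall>j\<in>{1..N}. m_step (\<nu> j - \<mu> (j - 1)) (int ell - 2 * int (\<mu> (j - 1)))
        (S (2 * j - 1)) (m j) (S (2 * j))) \<and>
     (\<forall>j\<in>{1..<N}. l_step (\<nu> j - \<mu> (j - 1)) (\<mu> j - \<nu> j) (int ell - 2 * int (\<mu> (j - 1)))
        (S (2 * j - 1)) (S (2 * j)) (l j) (S (2 * j + 1)))"

text \<open>\<open>cfrac a b t j k\<close> is the fraction
  \<open>1 / (a\<^sub>j + 1 / (b\<^sub>j + 1 / (a\<^bsub>j+1\<^esub> + \<dots> + 1 / (b\<^bsub>j+k-1\<^esub> + 1 / (a\<^bsub>j+k\<^esub> + 1 / t)))))\<close>.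
  The value \<open>t = \<infinity>\<close>, where the fraction terminates at \<open>a\<^bsub>j+k\<^esub>\<close>, is represented by
  \<open>t = 0\<close>, in accordance with \<open>1 / 0 = 0\<close>.\<close>

fun cfrac :: "(nat \<Rightarrow> complex) \<Rightarrow> (nat \<Rightarrow> complex) \<Rightarrow> complex \<Rightarrow> nat \<Rightarrow> nat \<Rightarrow> complex" where
  "cfrac a b t j 0 = 1 / (a j + 1 / t)"
| "cfrac a b t j (Suc k) = 1 / (a j + 1 / (b j + cfrac a b t (Suc j) k))"

text \<open>All denominators of the fraction, except possibly the parameter itself, are nonzero.\<close>

fun cfrac_defined :: "(nat \<Rightarrow> complex) \<Rightarrow> (nat \<Rightarrow> complex) \<Rightarrow> complex \<Rightarrow> nat \<Rightarrow> nat \<Rightarrow> bool" where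
  "cfrac_defined a b t j 0 \<longleftrightarrow> a j + 1 / t \<noteq> 0"
| "cfrac_defined a b t j (Suc k) \<longleftrightarrow>
     a j + 1 / (b j + cfrac a b t (Suc j) k) \<noteq> 0 \<and>
     b j + cfrac a b t (Suc j) k \<noteq> 0 \<and>
     cfrac_defined a b t (Suc j) k"

abbreviation cpoly :: "real poly \<Rightarrow> complex \<Rightarrow> complex" where
  "cpoly q w \<equiv> poly (map_poly complex_of_real q) w"

end

theory Submission
  imports Defs
begin

text \<open>Write \<open>G = F z\<^sub>1\<^bsup>p\<^sub>1\<^esup> \<cdots> z\<^sub>n\<^bsup>p\<^sub>n\<^esup>\<close>, which behaves like a function of one variable \<open>z = z\<^sub>1 \<cdots> z\<^sub>n\<close> with
  the moments \<open>\<ss>\<close>. The recurrence takes reciprocals of asymptotic expansions: if \<open>a\<close> is the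
  position of the leading term of \<open>-G\<close>, then \<open>-1/G = z m(z) - H\<close> with \<open>H\<close> of lower order, and
  likewise \<open>1/H = l(z) + G'\<close>, where \<open>G'\<close> has the same shape as \<open>G\<close>. The Toeplitz equations express
  exactly this passage to the reciprocal power series.

  That the positions of the leading terms are \<open>\<nu>\<^sub>j - \<mu>\<^bsub>j-1\<^esub>\<close> and \<open>\<mu>\<^sub>j - \<nu>\<^sub>j\<close> is a statement on
  complementary minors of two mutually inverse Toeplitz matrices. It is enough to compare kernels:
  if \<open>t u = 1\<close>, then \<open>t V \<equiv> W\<close> and \<open>V \<equiv> u W\<close> modulo \<open>x\<^bsup>a+2k\<^esup>\<close> say the same, with \<open>deg V < a + k\<close> and
  \<open>deg W < k\<close>; the first is a kernel vector of the Hankel matrix of size \<open>a + k\<close>, the second one of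
  the Hankel matrix of size \<open>k\<close> of the next sequence.\<close>


section \<open>Hankel determinants and reciprocal power series\<close>

text \<open>With \<open>x = 1/z\<close>, a sequence stands for the series with coefficient
  \<open>s i\<close> at \<open>x^(i+1)\<close>. If that series starts at \<open>x^a\<close>, this is
  the unit factor left after \<open>x^a\<close> is taken out.\<close>

definition lead_fps :: "nat \<Rightarrow> (int \<Rightarrow> real) \<Rightarrow> real fps" where
  "lead_fps a s = Abs_fps (\<lambda>d. s (int a - 1 + int d))"

text \<open>The coefficients of the negative reciprocal in the same convention: \<open>x^a t\<close>
  has the reciprocal \<open>x^(-a) u\<close>, in which \<open>x^(i+1)\<close> carries the
  coefficient of \<open>u\<close> at \<open>i + a + 1\<close>.\<close>

definition next_seq :: "nat \<Rightarrow> (int \<Rightarrow> real) \<Rightarrow> int \<Rightarrow> real" where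
  "next_seq a s i = - fps_nth (inverse (lead_fps a s)) (nat (i + int a + 1))"

text \<open>For \<open>a = 0\<close> this says only \<open>s (-1) \<noteq> 0\<close>. That case
  occurs for the even sequences, which begin at index \<open>-1\<close>, when \<nu> and \<mu>
  coincide.\<close>

definition leads :: "nat \<Rightarrow> (int \<Rightarrow> real) \<Rightarrow> bool" where
  "leads a s \<longleftrightarrow> (\<forall>i. 0 \<le> i \<and> i < int a - 1 \<longrightarrow> s i = 0) \<and> s (int a - 1) \<noteq> 0"

lemma leadsD: "leads a s \<Longrightarrow> 0 \<le> i \<Longrightarrow> i < int a - 1 \<Longrightarrow> s i = 0"
  by (auto simp: leads_def)

lemma lead_fps_nth [simp]: "fps_nth (lead_fps a s) d = s (int a - 1 + int d)"
  by (simp add: lead_fps_def)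

lemma lead_fps_inverse:
  assumes "s (int a - 1) \<noteq> 0"
  shows "inverse (lead_fps a s) * lead_fps a s = 1"
  by (rule inverse_mult_eq_1) (use assms in simp)

lemma fps_mult_nth_cong:
  fixes A B C :: "'a::semiring_1 fps"
  assumes "\<And>i. i < m \<Longrightarrow> fps_nth A i = fps_nth B i" "i < m"
  shows "fps_nth (C * A) i = fps_nth (C * B) i"
  unfolding fps_mult_nth by (rule sum.cong) (use assms in auto)

lemma complementary_kernel:
  fixes t u :: "'a::comm_ring_1 fps"
  assumes ut: "u * t = 1" and V: "V \<noteq> 0" "\<And>j. j \<ge> p \<Longrightarrow> fps_nth V j = 0"
    and ker: "\<And>i. k \<le> i \<Longrightarrow> i < p + k \<Longrightarrow> fps_nth (t * V) i = 0"
  obtains W where "W \<noteq> 0" "\<And>j. j \<ge> k \<Longrightarrow> fps_nth W j = 0"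
    "\<And>i. p \<le> i \<Longrightarrow> i < p + k \<Longrightarrow> fps_nth (u * W) i = 0"
proof
  \<comment> \<open>Above degree \<open>k\<close> the next \<open>p\<close> coefficients of
    \<open>t * V\<close> vanish, so cutting at \<open>k\<close> is invisible below degree
    \<open>p + k\<close> and \<open>u * W\<close> still returns \<open>V\<close> there.\<close>
  define W where "W = fps_cutoff k (t * V)"
  have uW: "fps_nth (u * W) i = fps_nth V i" if "i < p + k" for i
  proof -
    have "fps_nth (u * W) i = fps_nth (u * (t * V)) i"
      by (rule fps_mult_nth_cong[OF _ that]) (use ker in \<open>auto simp: W_def\<close>)
    also have "u * (t * V) = V"
      by (simp add: ut flip: mult.assoc)
    finally show ?thesis .
  qed
  show "W \<noteq> 0"
  proof
    assume "W = 0"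
    with uW have "fps_nth V i = 0" if "i < p + k" for i
      using that by auto
    with V(2) have "fps_nth V i = 0" for i
      by (cases "i < p + k") auto
    with V(1) show False
      by (auto simp: fps_eq_iff)
  qed
  show "fps_nth W j = 0" if "j \<ge> k" for j
    using that by (simp add: W_def)
  show "fps_nth (u * W) i = 0" if "p \<le> i" "i < p + k" for i
    using uW[OF that(2)] V(2)[OF that(1)] by simp
qed

text \<open>Kernel vectors are read backwards, as polynomials of degree below \<open>k\<close>. The
  reversal turns the Hankel sums into coefficients of a product of power series.\<close>

lemma hankel_eq_0_iff:
  "hankel s k = 0 \<longleftrightarrow>
     (\<exists>W. W \<noteq> 0 \<and> (\<forall>j\<ge>k. fps_nth W j = 0) \<and>
          (\<forall>i<k. (\<Sum>j<k. s (int i + int (k - 1 - j)) * fps_nth W j) = 0))"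
proof -
  let ?H = "mat k k (\<lambda>(i, j). s (int i + int j))"
  have H: "?H \<in> carrier_mat k k" by simp
  have prod: "vec_index (?H *\<^sub>v v) i = (\<Sum>j<k. s (int i + int (k - 1 - j)) * vec_index v (k - 1 - j))"
    if "v \<in> carrier_vec k" "i < k" for v i
  proof -
    have "vec_index (?H *\<^sub>v v) i = (\<Sum>j<k. s (int i + int j) * vec_index v j)"
      using that by (auto simp: scalar_prod_def atLeast0LessThan intro!: sum.cong)
    also have "\<dots> = (\<Sum>j<k. s (int i + int (k - 1 - j)) * vec_index v (k - 1 - j))"
      by (subst sum.nat_diff_reindex[symmetric]) simp
    finally show ?thesis .
  qed
  show ?thesis
  proof
    assume "hankel s k = 0"
    then obtain v where v: "v \<in> carrier_vec k" "v \<noteq> 0\<^sub>v k" "?H *\<^sub>v v = 0\<^sub>v k"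
      unfolding hankel_def det_0_iff_vec_prod_zero_field[OF H] by blast
    define W where "W = Abs_fps (\<lambda>j. if j < k then vec_index v (k - 1 - j) else 0)"
    have "W \<noteq> 0"
    proof
      assume "W = 0"
      have "vec_index v i = 0" if "i < k" for i
      proof -
        have "fps_nth W (k - 1 - i) = vec_index v i"
          using that by (auto simp: W_def)
        with \<open>W = 0\<close> show ?thesis by simp
      qed
      with v show False by (auto intro!: eq_vecI)
    qed
    moreover have "(\<Sum>j<k. s (int i + int (k - 1 - j)) * fps_nth W j) = 0" if "i < k" for i
      using prod[OF v(1) that] v(3) that by (simp add: W_def)
    ultimately show "\<exists>W. W \<noteq> 0 \<and> (\<forall>j\<ge>k. fps_nth W j = 0) \<and>
          (\<forall>i<k. (\<Sum>j<k. s (int i + int (k - 1 - j)) * fps_nth W j) = 0)"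
      by (intro exI[of _ W]) (auto simp: W_def)
  next
    assume "\<exists>W. W \<noteq> 0 \<and> (\<forall>j\<ge>k. fps_nth W j = 0) \<and>
          (\<forall>i<k. (\<Sum>j<k. s (int i + int (k - 1 - j)) * fps_nth W j) = 0)"
    then obtain W where W: "W \<noteq> 0" "\<And>j. j \<ge> k \<Longrightarrow> fps_nth W j = 0"
      "\<And>i. i < k \<Longrightarrow> (\<Sum>j<k. s (int i + int (k - 1 - j)) * fps_nth W j) = 0"
      by blast
    define v where "v = vec k (\<lambda>i. fps_nth W (k - 1 - i))"
    have v: "v \<in> carrier_vec k" by (simp add: v_def)
    have vn: "vec_index v (k - 1 - j) = fps_nth W j" if "j < k" for j
      using that by (auto simp: v_def)
    have "v \<noteq> 0\<^sub>v k"
    proof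
      assume v0: "v = 0\<^sub>v k"
      have "fps_nth W j = 0" for j
      proof (cases "j < k")
        case True
        then show ?thesis using vn[OF True] v0 by simp
      qed (use W in auto)
      with W(1) show False by (auto simp: fps_eq_iff)
    qed
    moreover have "?H *\<^sub>v v = 0\<^sub>v k"
    proof (rule eq_vecI)
      fix i assume "i < dim_vec (0\<^sub>v k :: real vec)"
      then have "i < k" by simp
      have "vec_index (?H *\<^sub>v v) i = (\<Sum>j<k. s (int i + int (k - 1 - j)) * fps_nth W j)"
        unfolding prod[OF v \<open>i < k\<close>] by (rule sum.cong) (simp_all only: vn lessThan_iff)
      with W(3)[OF \<open>i < k\<close>] \<open>i < k\<close> show "vec_index (?H *\<^sub>v v) i = vec_index (0\<^sub>v k) i"
        by simp
    qed simp
    ultimately show "hankel s k = 0"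
      unfolding hankel_def det_0_iff_vec_prod_zero_field[OF H] using v by blast
  qed
qed

lemma fps_mult_nth_supp:
  fixes A B :: "'a::comm_semiring_1 fps"
  assumes "\<And>j. j \<ge> k \<Longrightarrow> fps_nth B j = 0"
  shows "fps_nth (A * B) i = (\<Sum>j<k. if j \<le> i then fps_nth A (i - j) * fps_nth B j else 0)"
proof -
  have "fps_nth (A * B) i = (\<Sum>j\<le>i. fps_nth A (i - j) * fps_nth B j)"
    unfolding mult.commute[of A B] fps_mult_nth atLeast0AtMost
    by (rule sum.cong) (simp_all add: mult.commute)
  also have "\<dots> = (\<Sum>j\<in>{..i} \<inter> {..<k}. fps_nth A (i - j) * fps_nth B j)"
    by (rule sum.mono_neutral_right) (use assms in \<open>auto simp: not_less\<close>)
  also have "\<dots> = (\<Sum>j\<in>{..<k} \<inter> {j. j \<le> i}. fps_nth A (i - j) * fps_nth B j)"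
    by (rule sum.cong) auto
  also have "\<dots> = (\<Sum>j<k. if j \<le> i then fps_nth A (i - j) * fps_nth B j else 0)"
    by (subst sum.inter_restrict) (auto intro!: sum.cong)
  finally show ?thesis .
qed

lemma hankel_next_seq:
  assumes "leads a s"
  shows "hankel s (a + k) = 0 \<longleftrightarrow> hankel (next_seq a s) k = 0"
proof -
  define t where "t = lead_fps a s"
  define u where "u = inverse t"
  have ut: "u * t = 1"
    using assms unfolding u_def t_def by (intro lead_fps_inverse) (auto simp: leads_def)
  then have tu: "t * u = 1" by (simp add: mult.commute)
  \<comment> \<open>The kernel conditions for size \<open>a + k\<close> become the vanishing of
    coefficients \<open>k\<close> to \<open>a + 2k - 1\<close> of \<open>t * V\<close>. The terms
    with \<open>j > k + i\<close>, absent from the product, contain entries of \<open>s\<close>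
    before the leading one.\<close>
  have tV: "(\<Sum>j<a + k. s (int i + int (a + k - 1 - j)) * fps_nth V j) = fps_nth (t * V) (k + i)"
    if "\<And>j. j \<ge> a + k \<Longrightarrow> fps_nth V j = 0" for V i
    unfolding fps_mult_nth_supp[where k = "a + k", OF that, simplified]
  proof (rule sum.cong)
    fix j assume "j \<in> {..<a + k}"
    then have j: "j < a + k" by simp
    show "s (int i + int (a + k - 1 - j)) * fps_nth V j =
            (if j \<le> k + i then fps_nth t (k + i - j) * fps_nth V j else 0)"
    proof (cases "j \<le> k + i")
      case True
      then have "int i + int (a + k - 1 - j) = int a - 1 + int (k + i - j)"
        using j by linarith
      then show ?thesis using True by (simp only: t_def lead_fps_nth if_True)
    next
      case False
      then have "s (int i + int (a + k - 1 - j)) = 0"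
        using j by (intro leadsD[OF assms]) (auto simp: of_nat_diff)
      then show ?thesis using False by simp
    qed
  qed simp
  \<comment> \<open>For size \<open>k\<close> the window is \<open>a + k\<close> to
    \<open>a + 2k - 1\<close>. Here every \<open>j < k\<close> occurs in the product, so no entry
    has to vanish.\<close>
  have uW: "(\<Sum>j<k. next_seq a s (int i + int (k - 1 - j)) * fps_nth W j) = - fps_nth (u * W) (a + k + i)"
    if "\<And>j. j \<ge> k \<Longrightarrow> fps_nth W j = 0" for W i
    unfolding fps_mult_nth_supp[where k = k, OF that, simplified] sum_negf[symmetric]
  proof (rule sum.cong)
    fix j assume "j \<in> {..<k}"
    then have "j \<le> a + k + i" "nat (int i + int (k - 1 - j) + int a + 1) = a + k + i - j"
      by auto
    then show "next_seq a s (int i + int (k - 1 - j)) * fps_nth W j =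
        - (if j \<le> a + k + i then fps_nth u (a + k + i - j) * fps_nth W j else 0)"
      by (simp only: next_seq_def u_def t_def if_True mult_minus_left)
  qed simp
  show ?thesis
  proof
    assume "hankel s (a + k) = 0"
    then obtain V where V: "V \<noteq> 0" "\<And>j. j \<ge> a + k \<Longrightarrow> fps_nth V j = 0"
      "\<And>i. i < a + k \<Longrightarrow> (\<Sum>j<a + k. s (int i + int (a + k - 1 - j)) * fps_nth V j) = 0"
      unfolding hankel_eq_0_iff by blast
    have "fps_nth (t * V) i = 0" if "k \<le> i" "i < (a + k) + k" for i
      using V(3)[of "i - k"] tV[OF V(2), of "i - k"] that by simp
    then obtain W where W: "W \<noteq> 0" "\<And>j. j \<ge> k \<Longrightarrow> fps_nth W j = 0"
      "\<And>i. a + k \<le> i \<Longrightarrow> i < a + k + k \<Longrightarrow> fps_nth (u * W) i = 0"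
      using complementary_kernel[OF ut V(1), of "a + k" k] V(2) by metis
    then show "hankel (next_seq a s) k = 0"
      unfolding hankel_eq_0_iff using uW[OF W(2)] by (intro exI[of _ W]) auto
  next
    assume "hankel (next_seq a s) k = 0"
    then obtain W where W: "W \<noteq> 0" "\<And>j. j \<ge> k \<Longrightarrow> fps_nth W j = 0"
      "\<And>i. i < k \<Longrightarrow> (\<Sum>j<k. next_seq a s (int i + int (k - 1 - j)) * fps_nth W j) = 0"
      unfolding hankel_eq_0_iff by blast
    have "fps_nth (u * W) i = 0" if "a + k \<le> i" "i < k + (a + k)" for i
      using W(3)[of "i - (a + k)"] uW[OF W(2), of "i - (a + k)"] that by simp
    then obtain V where V: "V \<noteq> 0" "\<And>j. j \<ge> a + k \<Longrightarrow> fps_nth V j = 0"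
      "\<And>i. k \<le> i \<Longrightarrow> i < k + (a + k) \<Longrightarrow> fps_nth (t * V) i = 0"
      using complementary_kernel[OF tu W(1), of k "a + k"] W(2) by metis
    then show "hankel s (a + k) = 0"
      unfolding hankel_eq_0_iff using tV[OF V(2)] by (intro exI[of _ V]) auto
  qed
qed

section \<open>Leading positions as smallest normal indices\<close>

lemma hankel_0 [simp]: "hankel s 0 = 1"
  by (simp add: hankel_def)

lemma hankel_eq_0_of_zero_row:
  assumes "1 \<le> k" "\<And>i. 0 \<le> i \<Longrightarrow> i < int k \<Longrightarrow> s i = 0"
  shows "hankel s k = 0"
proof -
  let ?H = "mat k k (\<lambda>(i, j). s (int i + int j))"
  have "det ?H = (\<Sum>j<k. ?H $$ (0, j) * cofactor ?H 0 j)"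
    by (rule laplace_expansion_row) (use assms in auto)
  also have "\<dots> = 0"
    by (rule sum.neutral) (use assms in auto)
  finally show ?thesis by (simp add: hankel_def)
qed

text \<open>The complementary minor is the empty determinant. Together with
  \<open>hankel_eq_0_of_leads\<close>, a leading position \<open>a \<ge> 1\<close> is thus the
  smallest normal index.\<close>

lemma hankel_leads:
  assumes "leads a s"
  shows "hankel s a \<noteq> 0"
  using hankel_next_seq[OF assms, of 0] by simp

lemma hankel_eq_0_of_leads:
  assumes "leads a s" "1 \<le> k" "k < a"
  shows "hankel s k = 0"
  using assms by (intro hankel_eq_0_of_zero_row leadsD[OF assms(1)]) auto

lemma leads_exists:
  assumes "1 \<le> k" "hankel s k \<noteq> 0"
  obtains a where "1 \<le> a" "a \<le> k" "leads a s"
proof -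
  have ex: "\<exists>i. i < k \<and> s (int i) \<noteq> 0"
  proof (rule ccontr)
    assume *: "\<not> (\<exists>i. i < k \<and> s (int i) \<noteq> 0)"
    have "s i = 0" if "0 \<le> i" "i < int k" for i
      using *[simplified, rule_format, of "nat i"] that by auto
    with assms show False
      using hankel_eq_0_of_zero_row[of k s] by blast
  qed
  define b where "b = (LEAST i. i < k \<and> s (int i) \<noteq> 0)"
  have b: "b < k" "s (int b) \<noteq> 0"
    using LeastI_ex[OF ex] by (auto simp: b_def)
  have "s i = 0" if "0 \<le> i" "i < int b" for i
    using not_less_Least[of "nat i" "\<lambda>i. i < k \<and> s (int i) \<noteq> 0"] that b
    by (auto simp: b_def[symmetric] nat_less_iff)
  with b have "leads (Suc b) s"
    by (auto simp: leads_def)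
  with b show thesis
    using that[of "Suc b"] by simp
qed

section \<open>The shifted determinants\<close>

lemma hankel_plus_eq: "hankel_plus s k = hankel (\<lambda>i. s (i + 1)) k"
  by (simp add: hankel_plus_def hankel_def)

lemma hankel_cong:
  assumes "\<And>i. 0 \<le> i \<Longrightarrow> s i = s' i"
  shows "hankel s k = hankel s' k"
  unfolding hankel_def by (rule arg_cong[where f = det], rule cong_mat) (use assms in auto)

text \<open>The determinants \<open>D\<^sup>+\<close> are the Hankel determinants of \<open>z f\<close> if \<open>D\<close> are those of \<open>f\<close>, and
  \<open>f = 1 / (z m - g)\<close> gives \<open>z f = 1 / (m - g / z)\<close>; whence the index shift.\<close>

lemma hankel_plus_next_seq:
  assumes "1 \<le> n" "leads n s"
  shows "hankel_plus s (n - 1 + k) = 0 \<longleftrightarrow> hankel (\<lambda>i. next_seq n s (i - 1)) k = 0"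
proof -
  have l: "leads (n - 1) (\<lambda>i. s (i + 1))"
    using assms by (auto simp: leads_def of_nat_diff)
  \<comment> \<open>Shifting the sequence and lowering the leading position by one leave the series
    unchanged; only the numbering of its reciprocal moves, in the opposite direction.\<close>
  have t: "lead_fps (n - 1) (\<lambda>i. s (i + 1)) = lead_fps n s"
    using assms(1) by (intro fps_ext) (auto simp: of_nat_diff algebra_simps)
  have "hankel (next_seq (n - 1) (\<lambda>i. s (i + 1))) k = hankel (\<lambda>i. next_seq n s (i - 1)) k"
    by (rule hankel_cong) (use assms(1) in \<open>auto simp: next_seq_def t[simplified] of_nat_diff algebra_simps\<close>)
  then show ?thesis
    unfolding hankel_plus_eq hankel_next_seq[OF l] by simp
qed

text \<open>The converse shift: counting \<open>s\<close> from index \<open>-1\<close> raises the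
  leading position by one and keeps the series, so the reciprocal sequence is read one index
  later.\<close>

lemma hankel_next_seq_plus:
  assumes "leads (Suc r) (\<lambda>i. s (i - 1))"
  shows "hankel (\<lambda>i. s (i - 1)) (Suc r + k) = 0 \<longleftrightarrow> hankel_plus (next_seq r s) k = 0"
proof -
  have t: "lead_fps (Suc r) (\<lambda>i. s (i - 1)) = lead_fps r s"
    by (intro fps_ext) (auto simp: algebra_simps)
  have "hankel (next_seq (Suc r) (\<lambda>i. s (i - 1))) k = hankel (\<lambda>i. next_seq r s (i + 1)) k"
    by (rule hankel_cong) (auto simp: next_seq_def t algebra_simps)
  then show ?thesis
    unfolding hankel_plus_eq hankel_next_seq[OF assms] by simp
qed

lemma leads_shift:
  assumes "leads (Suc r) (\<lambda>i. s (i - 1))"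
  shows "leads r s"
  unfolding leads_def
proof (intro conjI allI impI)
  show "s i = 0" if "0 \<le> i \<and> i < int r - 1" for i
    using leadsD[OF assms, of "i + 1"] that by simp
  show "s (int r - 1) \<noteq> 0"
    using assms by (simp add: leads_def)
qed

section \<open>The determinant formulas for the atoms\<close>

abbreviation last_row_mat :: "(nat \<Rightarrow> nat \<Rightarrow> 'a) \<Rightarrow> (nat \<Rightarrow> 'a) \<Rightarrow> nat \<Rightarrow> 'a mat" where
  "last_row_mat A \<beta> n \<equiv> mat (Suc n) (Suc n) (\<lambda>(i, k). if i < n then A i k else \<beta> k)"

lemma cofactor_last_row_mat:
  assumes "k \<le> n"
  shows "cofactor (last_row_mat A \<beta> n) n k = cofactor (last_row_mat A \<gamma> n) n k"
  unfolding cofactor_def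
  by (rule arg_cong[where f = "\<lambda>M. (-1) ^ (n + k) * det M"])
     (auto simp: mat_delete_def)

lemma const_poly_hom: "comm_ring_hom (\<lambda>x::'a::comm_ring_1. [:x:])"
  by unfold_locales auto

lemma cofactor_last_row_mat_const:
  fixes A :: "nat \<Rightarrow> nat \<Rightarrow> 'a::comm_ring_1"
  assumes "k \<le> n"
  shows "cofactor (last_row_mat (\<lambda>i k. [:A i k:]) \<beta> n) n k = [:cofactor (last_row_mat A \<gamma> n) n k:]"
proof -
  interpret comm_ring_hom "\<lambda>x::'a. [:x:]"
    by (rule const_poly_hom)
  have "mat_delete (last_row_mat (\<lambda>i k. [:A i k:]) \<beta> n) n k =
      map_mat (\<lambda>x. [:x:]) (mat_delete (last_row_mat A \<gamma> n) n k)"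
    using assms by (auto simp: mat_delete_def)
  then have "det (mat_delete (last_row_mat (\<lambda>i k. [:A i k:]) \<beta> n) n k) =
      [:det (mat_delete (last_row_mat A \<gamma> n) n k):]"
    by (simp only: hom_det)
  moreover have "(-1 :: 'a poly) ^ (n + k) = [:(-1) ^ (n + k):]"
    by (simp only: hom_power hom_uminus hom_one)
  ultimately show ?thesis
    unfolding cofactor_def by simp
qed

lemma det_last_row_mat:
  "det (last_row_mat A \<beta> n) = (\<Sum>k\<le>n. \<beta> k * cofactor (last_row_mat A \<gamma> n) n k)"
proof -
  have "det (last_row_mat A \<beta> n) =
      (\<Sum>k<Suc n. last_row_mat A \<beta> n $$ (n, k) * cofactor (last_row_mat A \<beta> n) n k)"
    by (rule laplace_expansion_row) auto
  also have "\<dots> = (\<Sum>k\<le>n. \<beta> k * cofactor (last_row_mat A \<gamma> n) n k)"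
    unfolding lessThan_Suc_atMost
    by (rule sum.cong) (auto intro!: arg_cong2[where f = "(*)"] cofactor_last_row_mat)
  finally show ?thesis .
qed

lemma det_last_row_mat_monom:
  fixes A :: "nat \<Rightarrow> nat \<Rightarrow> 'a::comm_ring_1"
  shows "det (last_row_mat (\<lambda>i k. [:A i k:]) (\<lambda>k. monom 1 k) n) =
    (\<Sum>k\<le>n. monom (cofactor (last_row_mat A \<gamma> n) n k) k)"
proof -
  have "det (last_row_mat (\<lambda>i k. [:A i k:]) (\<lambda>k. monom 1 k) n) =
      (\<Sum>k\<le>n. monom 1 k * [:cofactor (last_row_mat A \<gamma> n) n k:])"
    unfolding det_last_row_mat[where \<beta> = "\<lambda>k. monom 1 k" and \<gamma> = "\<lambda>k. monom 1 k"]
    by (rule sum.cong) (auto simp: cofactor_last_row_mat_const[where \<gamma> = \<gamma>])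
  then show ?thesis
    by (simp add: monom_0[symmetric] mult_monom)
qed

lemma degree_det_last_row_mat:
  fixes A :: "nat \<Rightarrow> nat \<Rightarrow> 'a::comm_ring_1"
  shows "degree (det (last_row_mat (\<lambda>i k. [:A i k:]) (\<lambda>k. monom 1 k) n)) \<le> n"
  unfolding det_last_row_mat_monom[where \<gamma> = "\<lambda>k. 0"]
  by (rule degree_sum_le) (auto intro: order_trans[OF degree_monom_le])

text \<open>Replacing the last row \<open>1, z, \<dots>, z\<^sup>n\<close> by \<open>\<beta>\<close> amounts to applying to the determinant
  polynomial the linear functional \<open>z\<^sup>k \<mapsto> \<beta> k\<close>.\<close>

lemma sum_coeff_det_last_row:
  fixes A :: "nat \<Rightarrow> nat \<Rightarrow> 'a::comm_ring_1"
  shows "(\<Sum>k\<le>n. \<beta> k * coeff (det (last_row_mat (\<lambda>i k. [:A i k:]) (\<lambda>k. monom 1 k) n)) k) =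
    det (last_row_mat A \<beta> n)"
  unfolding det_last_row_mat_monom[where \<gamma> = \<beta>] det_last_row_mat[where A = A and \<gamma> = \<beta>]
  by (rule sum.cong) (auto simp: coeff_sum)

lemma det_last_row_mat_repeated:
  fixes A :: "nat \<Rightarrow> nat \<Rightarrow> 'a::comm_ring_1"
  assumes "e < n" "\<And>k. k \<le> n \<Longrightarrow> \<beta> k = A e k"
  shows "det (last_row_mat A \<beta> n) = 0"
  by (rule det_identical_rows[of _ "Suc n" e n])
     (use assms in \<open>auto intro!: eq_vecI\<close>)

lemma det_last_row_mat_unit:
  fixes A :: "nat \<Rightarrow> nat \<Rightarrow> 'a::comm_ring_1"
  assumes "\<And>k. k < n \<Longrightarrow> \<beta> k = 0"
  shows "det (last_row_mat A \<beta> n) = \<beta> n * det (mat n n (\<lambda>(i, k). A i k))"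
proof -
  have "det (last_row_mat A \<beta> n) = (\<Sum>k\<le>n. \<beta> k * cofactor (last_row_mat A \<beta> n) n k)"
    by (rule det_last_row_mat)
  also have "\<dots> = \<beta> n * cofactor (last_row_mat A \<beta> n) n n"
    by (subst sum.remove[of _ n]) (auto intro!: sum.neutral simp: assms)
  also have "mat_delete (last_row_mat A \<beta> n) n n = mat n n (\<lambda>(i, k). A i k)"
    by (auto simp: mat_delete_def)
  then have "cofactor (last_row_mat A \<beta> n) n n = det (mat n n (\<lambda>(i, k). A i k))"
    by (simp add: cofactor_def flip: mult_2)
  finally show ?thesis .
qed

text \<open>The first row is zero except for its last entry; deleting that row and the last column
  leaves the shifted determinant.\<close>

lemma hankel_Suc_leads:
  assumes "leads (Suc n) s"
  shows "hankel s (Suc n) = (-1) ^ n * s (int n) * hankel_plus s n"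
proof -
  let ?H = "mat (Suc n) (Suc n) (\<lambda>(i, j). s (int i + int j))"
  have "hankel s (Suc n) = (\<Sum>j<Suc n. ?H $$ (0, j) * cofactor ?H 0 j)"
    unfolding hankel_def by (rule laplace_expansion_row) auto
  also have "\<dots> = ?H $$ (0, n) * cofactor ?H 0 n"
    by (subst sum.remove[of _ n]) (use leadsD[OF assms] in \<open>auto intro!: sum.neutral\<close>)
  also have "mat_delete ?H 0 n = mat n n (\<lambda>(i, j). s (int i + int j + 1))"
    by (auto simp: mat_delete_def algebra_simps)
  then have "cofactor ?H 0 n = (-1) ^ n * hankel_plus s n"
    by (simp add: cofactor_def hankel_plus_def)
  finally show ?thesis by (simp add: mult_ac)
qed

text \<open>The equations say that the coefficients \<open>c\<close>, read backwards as a series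
  \<open>M\<close>, satisfy \<open>t * M = 1\<close> modulo \<open>x^(n+1)\<close>; multiplying by
  \<open>u\<close> identifies them. This is the test by which both determinant formulas are
  recognised as truncated reciprocals.\<close>

lemma coeff_eq_inverse_nth:
  fixes t u :: "'a::comm_ring_1 fps"
  assumes ut: "u * t = 1" and "d \<le> n"
    and eq: "\<And>e. e \<le> n \<Longrightarrow>
      (\<Sum>k\<le>n. (if n \<le> e + k then fps_nth t (e + k - n) else 0) * c k) = (if e = 0 then 1 else 0)"
  shows "c (n - d) = fps_nth u d"
proof -
  define M where "M = Abs_fps (\<lambda>d. if d \<le> n then c (n - d) else 0)"
  have tM: "fps_nth (t * M) e = fps_nth 1 e" if "e < Suc n" for e
  proof -
    have "fps_nth (t * M) e = (\<Sum>j<Suc n. if j \<le> e then fps_nth t (e - j) * fps_nth M j else 0)"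
      by (rule fps_mult_nth_supp) (simp add: M_def)
    also have "\<dots> = (\<Sum>k\<le>n. (if n \<le> e + k then fps_nth t (e + k - n) else 0) * c k)"
      by (rule sum.reindex_bij_witness[of _ "\<lambda>k. n - k" "\<lambda>k. n - k"]) (auto simp: M_def)
    finally show ?thesis
      using eq[of e] that by simp
  qed
  have "c (n - d) = fps_nth (u * (t * M)) d"
    using \<open>d \<le> n\<close> ut by (simp add: M_def flip: mult.assoc)
  also have "\<dots> = fps_nth (u * 1) d"
    by (rule fps_mult_nth_cong[OF tM]) (use \<open>d \<le> n\<close> in auto)
  finally show ?thesis by simp
qed

text \<open>The zeros prescribed in the upper left corner stand where the entries of
  \<open>s\<close> vanish anyway, and the sign exponent drops by two.\<close>

lemma m_poly_eq:
  assumes "leads (Suc n) s"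
  shows "m_poly (Suc n) s = smult ((-1) ^ n / hankel s (Suc n))
    (det (last_row_mat (\<lambda>i k. [:s (int i + int k + 1):]) (\<lambda>k. monom 1 k) n))"
  unfolding m_poly_def
  by (intro arg_cong2[where f = Polynomial.smult] arg_cong[where f = det] cong_mat)
     (use leadsD[OF assms] in auto)

lemma l_poly_eq:
  "l_poly r s = smult (1 / (s (int r - 1) * hankel s r))
    (det (last_row_mat (\<lambda>i k. [:s (int i + int k):]) (\<lambda>k. monom 1 k) r))"
  by (simp add: l_poly_def)

lemma degree_m_poly:
  assumes "leads n s" "1 \<le> n"
  shows "degree (m_poly n s) < n"
proof -
  obtain k where "n = Suc k" using assms(2) by (cases n) auto
  then show ?thesis
    using m_poly_eq[of k s] assms(1)
    by (auto intro!: le_imp_less_Suc order_trans[OF degree_smult_le] degree_det_last_row_mat)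
qed

lemma degree_l_poly: "degree (l_poly r s) \<le> r"
  unfolding l_poly_eq by (intro order_trans[OF degree_smult_le] degree_det_last_row_mat)

lemma sum_coeff_m_poly:
  assumes "leads (Suc n) s"
  shows "(\<Sum>k\<le>n. \<beta> k * coeff (m_poly (Suc n) s) k) =
    (-1) ^ n / hankel s (Suc n) * det (last_row_mat (\<lambda>i k. s (int i + int k + 1)) \<beta> n)"
  unfolding m_poly_eq[OF assms] sum_coeff_det_last_row[of \<beta>, symmetric]
  by (simp add: sum_distrib_left mult_ac)

text \<open>Equation \<open>e\<close> of the triangular system puts \<open>s e, s (e+1), ...\<close>
  into the last row of the determinant. For \<open>e \<ge> 1\<close> this repeats row
  \<open>e - 1\<close>; for \<open>e = 0\<close> only the last entry survives, and
  \<open>hankel_Suc_leads\<close> gives the normalisation.\<close>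

lemma m_poly_coeff:
  assumes "leads (Suc n) s" "d \<le> n"
  shows "coeff (m_poly (Suc n) s) (n - d) = fps_nth (inverse (lead_fps (Suc n) s)) d"
proof -
  define A where "A i k = s (int i + int k + 1)" for i k :: nat
  have nz: "hankel s (Suc n) \<noteq> 0"
    by (rule hankel_leads) fact
  show ?thesis
  proof (rule coeff_eq_inverse_nth[OF lead_fps_inverse])
    fix e assume "e \<le> n"
    define \<beta> where "\<beta> k = (if n \<le> e + k then fps_nth (lead_fps (Suc n) s) (e + k - n) else 0)" for k
    have \<beta>: "\<beta> k = s (int e + int k)" for k
      using leadsD[OF assms(1), of "int e + int k"] by (auto simp: \<beta>_def of_nat_diff)
    have "(-1) ^ n / hankel s (Suc n) * det (last_row_mat A \<beta> n) = (if e = 0 then 1 else 0)"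
    proof (cases "e = 0")
      case True
      have "det (last_row_mat A \<beta> n) = s (int n) * hankel_plus s n"
        using True leadsD[OF assms(1)] by (subst det_last_row_mat_unit) (auto simp: \<beta> A_def[abs_def] hankel_plus_def)
      then have "(-1) ^ n * det (last_row_mat A \<beta> n) = hankel s (Suc n)"
        by (simp add: hankel_Suc_leads[OF assms(1)])
      with True nz show ?thesis by (simp add: field_simps)
    next
      case False
      have "det (last_row_mat A \<beta> n) = 0"
        by (rule det_last_row_mat_repeated[of "e - 1"])
           (use False \<open>e \<le> n\<close> in \<open>auto simp: \<beta> A_def of_nat_diff algebra_simps\<close>)
      with False show ?thesis by simp
    qed
    with sum_coeff_m_poly[OF assms(1), of \<beta>] show "(\<Sum>k\<le>n. (if n \<le> e + k then fps_nth (lead_fps (Suc n) s) (e + k - n) else 0) *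
        coeff (m_poly (Suc n) s) k) = (if e = 0 then 1 else 0)"
      unfolding A_def \<beta>_def by simp
  qed (use assms in \<open>auto simp: leads_def\<close>)
qed

text \<open>As for \<open>m_poly_coeff\<close>, with the rows starting one index earlier: equation
  \<open>e\<close> repeats row \<open>e - 1\<close>, and \<open>e = 0\<close> leaves
  \<open>s (r - 1)\<close> times the minor of size \<open>r\<close>.\<close>

lemma l_poly_coeff:
  assumes "leads r s" "1 \<le> r" "d \<le> r"
  shows "coeff (l_poly r s) (r - d) = fps_nth (inverse (lead_fps r s)) d"
proof -
  define A where "A i k = s (int i + int k)" for i k :: nat
  have *: "(\<Sum>k\<le>r. \<beta> k * coeff (l_poly r s) k) =
      det (last_row_mat A \<beta> r) / (s (int r - 1) * hankel s r)" for \<beta>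
    unfolding l_poly_eq A_def sum_coeff_det_last_row[of \<beta>, symmetric]
    by (simp add: sum_divide_distrib mult_ac)
  have nz: "hankel s r \<noteq> 0" "s (int r - 1) \<noteq> 0"
    using hankel_leads[OF assms(1)] assms(1) by (auto simp: leads_def)
  show ?thesis
  proof (rule coeff_eq_inverse_nth[OF lead_fps_inverse])
    fix e assume "e \<le> r"
    \<comment> \<open>The cutoff matters at \<open>e = 0\<close>, \<open>k = 0\<close>: the entry
      there would be \<open>s (-1)\<close>, about which \<open>leads r s\<close> says nothing when
      \<open>r \<ge> 1\<close>.\<close>
    define \<beta> where "\<beta> k = (if r \<le> e + k then fps_nth (lead_fps r s) (e + k - r) else 0)" for k
    have "det (last_row_mat A \<beta> r) / (s (int r - 1) * hankel s r) = (if e = 0 then 1 else 0)"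
    proof (cases "e = 0")
      case True
      have "det (last_row_mat A \<beta> r) = s (int r - 1) * hankel s r"
        using True by (subst det_last_row_mat_unit) (auto simp: \<beta>_def A_def[abs_def] hankel_def)
      with True nz show ?thesis by simp
    next
      case False
      have "\<beta> k = A (e - 1) k" for k
        using leadsD[OF assms(1), of "int e - 1 + int k"] False
        by (auto simp: \<beta>_def A_def of_nat_diff algebra_simps)
      then have "det (last_row_mat A \<beta> r) = 0"
        by (intro det_last_row_mat_repeated[of "e - 1"]) (use False \<open>e \<le> r\<close> in auto)
      with False show ?thesis by simp
    qed
    with * show "(\<Sum>k\<le>r. (if r \<le> e + k then fps_nth (lead_fps r s) (e + k - r) else 0) *
        coeff (l_poly r s) k) = (if e = 0 then 1 else 0)"
      unfolding \<beta>_def by simp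
  qed (use assms nz in auto)
qed

text \<open>Put \<open>s (n+1), s (n+2), ...\<close> into the last row of the determinant for
  \<open>m\<close>. As the coefficients of \<open>m\<close> are those of \<open>u\<close>, the
  result is coefficient \<open>n + 1\<close> of \<open>u * t = 1\<close> without its term
  \<open>u (n+1) t 0\<close>, and \<open>u (n+1)\<close> is minus the next sequence at
  \<open>-1\<close>. This reconciles the two formulas for \<open>l\<close> in the constant
  case.\<close>

lemma hankel_plus_Suc_leads:
  assumes "leads (Suc n) s"
  shows "hankel_plus s (Suc n) =
    (-1) ^ n * s (int n) * hankel s (Suc n) * next_seq (Suc n) s (-1)"
proof -
  define t where "t = lead_fps (Suc n) s"
  define u where "u = inverse t"
  have ut: "u * t = 1"
    using assms unfolding u_def t_def by (intro lead_fps_inverse) (auto simp: leads_def)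
  have nz: "hankel s (Suc n) \<noteq> 0"
    by (rule hankel_leads) fact
  have "hankel_plus s (Suc n) = det (last_row_mat (\<lambda>i k. s (int i + int k + 1)) (\<lambda>k. s (int n + int k + 1)) n)"
    unfolding hankel_plus_def
    by (intro arg_cong[where f = det] cong_mat) (auto simp: less_Suc_eq)
  then have "(-1) ^ n / hankel s (Suc n) * hankel_plus s (Suc n) =
      (\<Sum>k\<le>n. s (int n + int k + 1) * coeff (m_poly (Suc n) s) k)"
    by (simp add: sum_coeff_m_poly[OF assms])
  also have "\<dots> = (\<Sum>d\<le>n. s (int n + int (n - d) + 1) * coeff (m_poly (Suc n) s) (n - d))"
    by (rule sum.reindex_bij_witness[of _ "\<lambda>k. n - k" "\<lambda>k. n - k"]) auto
  also have "\<dots> = (\<Sum>d\<le>n. fps_nth u d * fps_nth t (Suc n - d))"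
    by (rule sum.cong) (auto simp: m_poly_coeff[OF assms] u_def t_def Suc_diff_le of_nat_diff algebra_simps)
  also have "\<dots> = fps_nth (u * t) (Suc n) - fps_nth u (Suc n) * s (int n)"
    by (simp add: fps_mult_nth atLeast0AtMost t_def)
  also have "\<dots> = - (fps_nth u (Suc n) * s (int n))"
    by (simp add: ut)
  also have "\<dots> = s (int n) * next_seq (Suc n) s (-1)"
    by (simp add: next_seq_def u_def t_def nat_add_distrib)
  finally have "(-1) ^ n * ((-1) ^ n * hankel_plus s (Suc n)) =
      (-1) ^ n * (s (int n) * next_seq (Suc n) s (-1) * hankel s (Suc n))"
    using nz by (simp add: field_simps)
  then show ?thesis
    by (simp add: mult_ac flip: power_add mult_2)
qed

section \<open>Toeplitz equations as truncated products of power series\<close>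

lemma toeplitz_inverse:
  assumes "u * t = 1"
  shows "toeplitz (map (fps_nth u) [0..<n]) * toeplitz (map (fps_nth t) [0..<n]) = 1\<^sub>m n"
proof (rule eq_matI)
  fix i k assume "i < dim_row (1\<^sub>m n :: real mat)" "k < dim_col (1\<^sub>m n :: real mat)"
  then have ik: "i < n" "k < n" by auto
  have "(toeplitz (map (fps_nth u) [0..<n]) * toeplitz (map (fps_nth t) [0..<n])) $$ (i, k) =
      (\<Sum>j<n. (if i \<le> j then fps_nth u (j - i) else 0) * (if j \<le> k then fps_nth t (k - j) else 0))"
    using ik by (auto simp: toeplitz_def scalar_prod_def atLeast0LessThan intro!: sum.cong)
  also have "\<dots> = (\<Sum>j\<in>{i..k}. fps_nth u (j - i) * fps_nth t (k - j))"
    by (rule sum.mono_neutral_cong_right) (use ik in auto)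
  also have "\<dots> = (if i \<le> k then fps_nth (u * t) (k - i) else 0)"
  proof (cases "i \<le> k")
    case True
    then have "(\<Sum>j\<in>{i..k}. fps_nth u (j - i) * fps_nth t (k - j)) =
        (\<Sum>d\<in>{0..k - i}. fps_nth u d * fps_nth t (k - i - d))"
      by (intro sum.reindex_bij_witness[of _ "\<lambda>d. d + i" "\<lambda>j. j - i"]) auto
    with True show ?thesis by (simp add: fps_mult_nth)
  qed auto
  also have "\<dots> = 1\<^sub>m n $$ (i, k)"
    using ik assms by auto
  finally show "(toeplitz (map (fps_nth u) [0..<n]) * toeplitz (map (fps_nth t) [0..<n])) $$ (i, k) =
      1\<^sub>m n $$ (i, k)" .
qed (auto simp: toeplitz_def)

text \<open>Both Toeplitz equations of the recurrence are instances of the following one, with \<open>a = \<nu>\<close>,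
  \<open>b = \<nu>\<close> and \<open>a = \<mu>\<close>, \<open>b = \<mu> + 1\<close> respectively.\<close>

lemma toeplitz_next_seq:
  assumes lead: "s (int a - 1) \<noteq> 0" and "1 \<le> b" "a \<le> b"
    and c: "\<And>d. d < b \<Longrightarrow> coeff q (b - 1 - d) = fps_nth (inverse (lead_fps a s)) d"
    and K: "int b - int a - 2 \<le> K"
  shows "toeplitz (map (coeff q) (rev [0..<b]) @ map (\<lambda>i. - next_seq a s i) [int b - int a - 1..K])
    * toeplitz (map s [int a - 1..K + 2 * int a]) = 1\<^sub>m (nat (K + int a + 2))"
proof -
  let ?n = "nat (K + int a + 2)" and ?t = "lead_fps a s"
  have "map s [int a - 1..K + 2 * int a] = map (fps_nth ?t) [0..<?n]"
    using K by (intro nth_equalityI) auto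
  moreover have "map (coeff q) (rev [0..<b]) @ map (\<lambda>i. - next_seq a s i) [int b - int a - 1..K] =
      map (fps_nth (inverse ?t)) [0..<?n]"
  proof (rule nth_equalityI)
    show len: "length (map (coeff q) (rev [0..<b]) @ map (\<lambda>i. - next_seq a s i) [int b - int a - 1..K]) =
        length (map (fps_nth (inverse ?t)) [0..<?n])"
      using K by auto
    fix i assume "i < length (map (coeff q) (rev [0..<b]) @ map (\<lambda>i. - next_seq a s i) [int b - int a - 1..K])"
    with len have i: "i < ?n" by simp
    show "(map (coeff q) (rev [0..<b]) @ map (\<lambda>i. - next_seq a s i) [int b - int a - 1..K]) ! i =
        map (fps_nth (inverse ?t)) [0..<?n] ! i"
    proof (cases "i < b")
      case True
      then show ?thesis using i c[of i] by (simp add: nth_append rev_nth)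
    next
      case False
      then have "nat (int b - int a - 1 + int (i - b) + int a + 1) = i" by linarith
      moreover have "int b - int a - 1 + int (i - b) \<le> K" using False i K by linarith
      ultimately show ?thesis
        using False i by (simp add: nth_append next_seq_def)
    qed
  qed
  ultimately show ?thesis
    using toeplitz_inverse[OF lead_fps_inverse[of s a, OF lead]] by simp
qed

lemma m_step_next_seq:
  assumes "1 \<le> n" "leads n s" "2 * int n - 2 \<le> L"
  shows "m_step n L s (m_poly n s) (next_seq n s)"
  unfolding m_step_def
proof (intro conjI refl)
  \<comment> \<open>Here \<open>K = L - 2n\<close>, and the smallest admissible value
    \<open>-2\<close> is attained at the last atom, where the list contains coefficients of
    \<open>m\<close> only.\<close>
  have "toeplitz (map (coeff (m_poly n s)) (rev [0..<n]) @
        map (\<lambda>i. - next_seq n s i) [int n - int n - 1..L - 2 * int n])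
      * toeplitz (map s [int n - 1..L - 2 * int n + 2 * int n]) = 1\<^sub>m (nat (L - 2 * int n + int n + 2))"
  proof (rule toeplitz_next_seq)
    show "coeff (m_poly n s) (n - 1 - d) = fps_nth (inverse (lead_fps n s)) d" if "d < n" for d
      using m_poly_coeff[of "n - 1" s d] assms that by simp
  qed (use assms in \<open>auto simp: leads_def\<close>)
  then show "toeplitz (map (coeff (m_poly n s)) (rev [0..<n]) @ map (\<lambda>i. - next_seq n s i) [-1..L - 2 * int n])
      * toeplitz (map s [int n - 1..L]) = 1\<^sub>m (nat (L - int n + 2))"
    by (simp add: algebra_simps)
qed

definition l_atom :: "nat \<Rightarrow> (int \<Rightarrow> real) \<Rightarrow> real poly" where
  "l_atom r s = (if r = 0 then [:1 / s (-1):] else l_poly r s)"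

lemma degree_l_atom: "degree (l_atom r s) \<le> r"
  by (simp add: l_atom_def degree_l_poly)

lemma l_atom_coeff:
  assumes "leads r s" "d \<le> r"
  shows "coeff (l_atom r s) (r - d) = fps_nth (inverse (lead_fps r s)) d"
  using l_poly_coeff[of r s d] assms
  by (auto simp: l_atom_def leads_def fps_inverse_nth_0 divide_inverse)

lemma l_step_next_seq:
  assumes "1 \<le> n" "leads n s" "leads r (next_seq n s)" "2 * int n + 2 * int r - 1 \<le> L"
  shows "l_step n r L s (next_seq n s) (l_atom r (next_seq n s)) (next_seq r (next_seq n s))"
  unfolding l_step_def
proof (intro conjI)
  let ?s' = "next_seq n s"
  \<comment> \<open>A constant atom must agree with both of its prescribed expressions; the
    determinant quotient is evaluated through the shifted determinant of size
    \<open>n\<close>.\<close>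
  have "(-1) ^ (n + 1) * s (int n - 1) * (hankel s n / hankel_plus s n) = 1 / ?s' (-1)" if "r = 0"
  proof -
    from assms(1) obtain k where k: "n = Suc k" by (cases n) auto
    have nz: "?s' (-1) \<noteq> 0" "hankel s n \<noteq> 0" "s (int n - 1) \<noteq> 0"
      using assms that hankel_leads[of n s] by (auto simp: leads_def)
    have "hankel_plus s n = (-1) ^ k * s (int n - 1) * hankel s n * ?s' (-1)"
      using hankel_plus_Suc_leads[of k s] assms(2) by (simp add: k)
    with nz show ?thesis by (simp add: k field_simps)
  qed
  then show "if r = 0 then l_atom r ?s' = [:1 / ?s' (-1):] \<and>
       l_atom r ?s' = [:(-1) ^ (n + 1) * s (int n - 1) * (hankel s n / hankel_plus s n):]
     else l_atom r ?s' = l_poly r ?s'"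
    by (simp add: l_atom_def)
  have "toeplitz (map (coeff (l_atom r ?s')) (rev [0..<r + 1]) @
        map (\<lambda>i. - next_seq r ?s' i) [int (r + 1) - int r - 1..L - 2 * int n - 2 * int r])
      * toeplitz (map ?s' [int r - 1..L - 2 * int n - 2 * int r + 2 * int r])
      = 1\<^sub>m (nat (L - 2 * int n - 2 * int r + int r + 2))"
  proof (rule toeplitz_next_seq)
    show "coeff (l_atom r ?s') (r + 1 - 1 - d) = fps_nth (inverse (lead_fps r ?s')) d" if "d < r + 1" for d
      using l_atom_coeff[OF assms(3), of d] that by simp
  qed (use assms in \<open>auto simp: leads_def\<close>)
  then show "toeplitz (map (coeff (l_atom r ?s')) (rev [0..<r + 1]) @
        map (\<lambda>i. - next_seq r ?s' i) [0..L - 2 * int n - 2 * int r])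
      * toeplitz (map ?s' [int r - 1..L - 2 * int n]) = 1\<^sub>m (nat (L - 2 * int n - int r + 2))"
    by (simp add: algebra_simps)
qed

section \<open>Normal indices along the recurrence\<close>

text \<open>Two reciprocals in succession, for the plain and for the shifted determinants. The
  leading position of the middle sequence is counted from index \<open>-1\<close>, because its
  constant term must vanish too when \<open>r \<ge> 1\<close>.\<close>

lemma hankel_two_steps:
  assumes "1 \<le> n" "leads n s" "leads (Suc r) (\<lambda>i. next_seq n s (i - 1))"
  shows "hankel s (n + r + k) = 0 \<longleftrightarrow> hankel (next_seq r (next_seq n s)) k = 0"
    and "hankel_plus s (n + r + k) = 0 \<longleftrightarrow> hankel_plus (next_seq r (next_seq n s)) k = 0"
proof -
  show "hankel s (n + r + k) = 0 \<longleftrightarrow> hankel (next_seq r (next_seq n s)) k = 0"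
    using hankel_next_seq[OF assms(2), of "r + k"] hankel_next_seq[OF leads_shift[OF assms(3)], of k]
    by (simp add: add.assoc)
  \<comment> \<open>For the shifted determinants the two reductions take off \<open>n - 1\<close>
    and \<open>r + 1\<close> rows instead of \<open>n\<close> and \<open>r\<close>.\<close>
  have "n + r + k = n - 1 + (Suc r + k)"
    using assms(1) by simp
  then show "hankel_plus s (n + r + k) = 0 \<longleftrightarrow> hankel_plus (next_seq r (next_seq n s)) k = 0"
    using hankel_plus_next_seq[OF assms(1,2), of "Suc r + k"] hankel_next_seq_plus[OF assms(3), of k]
    by (simp only:)
qed

text \<open>Entry \<open>j\<close> is the sequence with superscript \<open>2j + 1\<close> of the
  recurrence.\<close>

primrec odd_seq :: "(nat \<Rightarrow> nat) \<Rightarrow> (nat \<Rightarrow> nat) \<Rightarrow> (int \<Rightarrow> real) \<Rightarrow> nat \<Rightarrow> int \<Rightarrow> real" where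
  "odd_seq \<nu> \<mu> s 0 = s"
| "odd_seq \<nu> \<mu> s (Suc j) =
     next_seq (\<mu> (Suc j) - \<nu> (Suc j)) (next_seq (\<nu> (Suc j) - \<mu> j) (odd_seq \<nu> \<mu> s j))"

locale normal_enum =
  fixes s :: "int \<Rightarrow> real" and N ell :: nat and \<nu> \<mu> :: "nat \<Rightarrow> nat"
  assumes N: "1 \<le> N"
    and ell: "ell = 2 * \<nu> N - 2"
    and \<nu>: "strict_mono_on {1..N} \<nu>" "\<nu> ` {1..N} = nu_indices s ell"
    and \<mu>: "strict_mono_on {1..<N} \<mu>" "\<mu> ` {1..<N} = mu_indices s ell"
    and \<mu>_0: "\<mu> 0 = 0"
begin

text \<open>Counting from \<open>0\<close>: \<open>n j\<close> and \<open>r j\<close> are the sizes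
  of the recurrence step numbered \<open>j + 1\<close>.\<close>

definition "n j = \<nu> (Suc j) - \<mu> j"
definition "r j = \<mu> (Suc j) - \<nu> (Suc j)"
abbreviation "S \<equiv> odd_seq \<nu> \<mu> s"

lemma nu_mono: "1 \<le> i \<Longrightarrow> i \<le> j \<Longrightarrow> j \<le> N \<Longrightarrow> \<nu> i \<le> \<nu> j"
  using strict_mono_on_leD[OF \<nu>(1), of i j] by auto

lemma nu_less_iff: "1 \<le> i \<Longrightarrow> i \<le> N \<Longrightarrow> 1 \<le> j \<Longrightarrow> j \<le> N \<Longrightarrow> \<nu> i < \<nu> j \<longleftrightarrow> i < j"
  using strict_mono_on_less[OF \<nu>(1), of i j] by auto

lemma mu_less_iff: "1 \<le> i \<Longrightarrow> i < N \<Longrightarrow> 1 \<le> j \<Longrightarrow> j < N \<Longrightarrow> \<mu> i < \<mu> j \<longleftrightarrow> i < j"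
  using strict_mono_on_less[OF \<mu>(1), of i j] by auto

lemma nu_in:
  assumes "1 \<le> i" "i \<le> N"
  shows "1 \<le> \<nu> i" "hankel s (\<nu> i) \<noteq> 0" "hankel_plus s (\<nu> i - 1) \<noteq> 0"
proof -
  have "\<nu> i \<in> nu_indices s ell"
    using \<nu>(2) assms by auto
  then show "1 \<le> \<nu> i" "hankel s (\<nu> i) \<noteq> 0" "hankel_plus s (\<nu> i - 1) \<noteq> 0"
    by (auto simp: nu_indices_def normal_indices_def)
qed

lemma mu_in:
  assumes "1 \<le> i" "i < N"
  shows "1 \<le> \<mu> i" "hankel s (\<mu> i) \<noteq> 0" "hankel_plus s (\<mu> i) \<noteq> 0" "2 * int (\<mu> i) - 1 \<le> int ell"
proof -
  have "\<mu> i \<in> mu_indices s ell"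
    using \<mu>(2) assms by auto
  then show "1 \<le> \<mu> i" "hankel s (\<mu> i) \<noteq> 0" "hankel_plus s (\<mu> i) \<noteq> 0" "2 * int (\<mu> i) - 1 \<le> int ell"
    by (auto simp: mu_indices_def normal_indices_def)
qed

lemma in_nu:
  assumes "1 \<le> k" "k \<le> \<nu> N" "hankel s k \<noteq> 0" "hankel_plus s (k - 1) \<noteq> 0"
  obtains i where "1 \<le> i" "i \<le> N" "k = \<nu> i"
proof -
  have "k \<in> nu_indices s ell"
    using assms nu_in(1)[of N] N by (auto simp: nu_indices_def normal_indices_def ell)
  then have "k \<in> \<nu> ` {1..N}"
    unfolding \<nu>(2) .
  then show thesis
    using that by auto
qed

lemma in_mu:
  assumes "1 \<le> k" "2 * int k - 1 \<le> int ell" "hankel s k \<noteq> 0" "hankel_plus s k \<noteq> 0"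
  obtains i where "1 \<le> i" "i < N" "k = \<mu> i"
proof -
  have "k \<in> mu_indices s ell"
    using assms by (auto simp: mu_indices_def normal_indices_def)
  then have "k \<in> \<mu> ` {1..<N}"
    unfolding \<mu>(2) .
  then show thesis
    using that by auto
qed

text \<open>The induction invariant: both families of determinants of the \<open>j\<close>-th odd
  sequence vanish exactly as those of \<open>s\<close> beyond \<mu>, and exactly the first
  \<open>j\<close> values of \<nu> have been passed. The interlacing of \<nu> and \<mu> is derived
  along with it.\<close>

definition stage :: "nat \<Rightarrow> bool" where
  "stage j \<longleftrightarrow> (\<forall>k. hankel (S j) k = 0 \<longleftrightarrow> hankel s (\<mu> j + k) = 0) \<and>
     (\<forall>k. hankel_plus (S j) k = 0 \<longleftrightarrow> hankel_plus s (\<mu> j + k) = 0) \<and>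
     (\<forall>i\<in>{1..N}. i \<le> j \<longleftrightarrow> \<nu> i \<le> \<mu> j)"

lemma stage_hankel: "stage j \<Longrightarrow> hankel (S j) k = 0 \<longleftrightarrow> hankel s (\<mu> j + k) = 0"
  and stage_hankel_plus: "stage j \<Longrightarrow> hankel_plus (S j) k = 0 \<longleftrightarrow> hankel_plus s (\<mu> j + k) = 0"
  and stage_nu: "stage j \<Longrightarrow> 1 \<le> i \<Longrightarrow> i \<le> N \<Longrightarrow> i \<le> j \<longleftrightarrow> \<nu> i \<le> \<mu> j"
  by (auto simp: stage_def)

lemma stage_0: "stage 0"
  unfolding stage_def \<mu>_0 using nu_in(1) by fastforce

text \<open>A nonzero minor of size \<open>n j\<close> forces a leading position
  \<open>a \<le> n j\<close>. At \<open>a\<close> the minors have the pattern of a \<nu>-index of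
  \<open>s\<close>, so \<open>\<mu> j + a\<close> is some \<nu> beyond the first \<open>j\<close>;
  being at most the next one, it equals it.\<close>

lemma stage_leads:
  assumes "stage j" "j < N"
  shows "\<mu> j < \<nu> (Suc j)" "leads (n j) (S j)"
proof -
  show less: "\<mu> j < \<nu> (Suc j)"
    using stage_nu[OF assms(1), of "Suc j"] assms(2) by auto
  have "hankel (S j) (n j) \<noteq> 0"
    using nu_in(2)[of "Suc j"] less assms(2) by (simp add: stage_hankel[OF assms(1)] n_def)
  moreover have "1 \<le> n j"
    using less by (simp add: n_def)
  ultimately obtain a where a: "1 \<le> a" "a \<le> n j" "leads a (S j)"
    using leads_exists by blast
  have "hankel s (\<mu> j + a) \<noteq> 0"
    using hankel_leads[OF a(3)] by (simp add: stage_hankel[OF assms(1)])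
  \<comment> \<open>The complementary minor is empty, hence nonzero.\<close>
  moreover have "hankel_plus s (\<mu> j + a - 1) \<noteq> 0"
    using hankel_plus_next_seq[OF a(1,3), of 0] a(1) stage_hankel_plus[OF assms(1), of "a - 1"]
    by simp
  moreover have "\<mu> j + a \<le> \<nu> (Suc j)"
    using a(2) less by (simp add: n_def)
  moreover have "\<nu> (Suc j) \<le> \<nu> N"
    using assms(2) by (intro nu_mono) auto
  ultimately obtain i where i: "1 \<le> i" "i \<le> N" "\<mu> j + a = \<nu> i"
    using in_nu[of "\<mu> j + a"] a(1) by auto
  have "Suc j \<le> i"
    using stage_nu[OF assms(1) i(1,2)] i(3) a(1) by auto
  then have "\<nu> (Suc j) \<le> \<nu> i"
    using i by (intro nu_mono) auto
  with \<open>\<mu> j + a \<le> \<nu> (Suc j)\<close> i(3) have "a = n j"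
    by (simp add: n_def)
  with a show "leads (n j) (S j)" by simp
qed

text \<open>The same argument for \<mu>. The shifted minor at the next \<mu> is nonzero, so the
  middle sequence, read from index \<open>-1\<close>, has a leading position \<open>q + 1\<close>.
  Two steps with empty minors make \<open>\<mu> j + n j + q\<close> a \<mu>-index at most the next
  one, hence equal to it.\<close>

lemma stage_leads2:
  assumes st: "stage j" and j: "Suc j < N"
  shows "\<nu> (Suc j) \<le> \<mu> (Suc j)"
    and "leads (Suc (r j)) (\<lambda>i. next_seq (n j) (S j) (i - 1))"
proof -
  have nu: "\<mu> j < \<nu> (Suc j)" and l: "leads (n j) (S j)"
    using stage_leads[OF st] j by auto
  have n1: "1 \<le> n j" and \<nu>_eq: "\<nu> (Suc j) = \<mu> j + n j"
    using nu by (auto simp: n_def)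
  have mu: "\<mu> j < \<mu> (Suc j)"
    using mu_less_iff[of j "Suc j"] mu_in(1)[of "Suc j"] j \<mu>_0 by (cases j) auto
  define k where "k = \<mu> (Suc j) - \<mu> j"
  have k: "\<mu> (Suc j) = \<mu> j + k" "1 \<le> k"
    using mu by (auto simp: k_def)
  have "hankel (S j) k \<noteq> 0" and pk: "hankel_plus (S j) k \<noteq> 0"
    using mu_in(2,3)[of "Suc j"] j by (simp_all add: stage_hankel[OF st] stage_hankel_plus[OF st] k)
  then have nk: "n j \<le> k"
    using hankel_eq_0_of_leads[OF l k(2)] by (meson not_less)
  then show "\<nu> (Suc j) \<le> \<mu> (Suc j)"
    by (simp add: k \<nu>_eq)
  let ?g = "\<lambda>i. next_seq (n j) (S j) (i - 1)"
  have "hankel ?g (Suc (k - n j)) \<noteq> 0"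
    using hankel_plus_next_seq[OF n1 l, of "Suc (k - n j)"] pk n1 nk by simp
  then obtain b where b: "1 \<le> b" "b \<le> Suc (k - n j)" "leads b ?g"
    using leads_exists[of "Suc (k - n j)" ?g] by auto
  then obtain q where q: "b = Suc q" by (cases b) auto
  have lq: "leads (Suc q) ?g" using b q by simp
  have "hankel (S j) (n j + q) \<noteq> 0" "hankel_plus (S j) (n j + q) \<noteq> 0"
    using hankel_two_steps[OF n1 l lq, of 0] by (simp_all add: hankel_plus_eq)
  then have nz: "hankel s (\<mu> j + (n j + q)) \<noteq> 0" "hankel_plus s (\<mu> j + (n j + q)) \<noteq> 0"
    by (simp_all add: stage_hankel[OF st] stage_hankel_plus[OF st])
  have le: "\<mu> j + (n j + q) \<le> \<mu> (Suc j)"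
    using b(2) q nk k by simp
  then have "2 * int (\<mu> j + (n j + q)) - 1 \<le> int ell"
    using mu_in(4)[of "Suc j"] j by simp
  then obtain i where i: "1 \<le> i" "i < N" "\<mu> j + (n j + q) = \<mu> i"
    using in_mu[of "\<mu> j + (n j + q)"] nz n1 by auto
  have "j < i"
    using mu_less_iff[of j i] i n1 j by (cases j) auto
  then have "\<mu> (Suc j) \<le> \<mu> i"
    using mu_less_iff[of i "Suc j"] i j by auto
  with le i(3) have "q = r j"
    by (simp add: r_def \<nu>_eq)
  with lq show "leads (Suc (r j)) ?g" by simp
qed

lemma stage_Suc:
  assumes st: "stage j" and j: "Suc j < N"
  shows "stage (Suc j)"
proof -
  note l = stage_leads(2)[OF st Suc_lessD[OF j]]
  have n1: "1 \<le> n j" and \<nu>_eq: "\<nu> (Suc j) = \<mu> j + n j"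
    using stage_leads(1)[OF st Suc_lessD[OF j]] by (auto simp: n_def)
  note l2 = stage_leads2(2)[OF st j]
  have \<mu>_eq: "\<mu> (Suc j) = \<mu> j + (n j + r j)"
    using stage_leads2(1)[OF st j] by (simp add: \<nu>_eq r_def)
  have S: "S (Suc j) = next_seq (r j) (next_seq (n j) (S j))"
    by (simp add: r_def n_def)
  have h: "hankel (S (Suc j)) k = 0 \<longleftrightarrow> hankel s (\<mu> (Suc j) + k) = 0" for k
    unfolding S using hankel_two_steps(1)[OF n1 l l2, of k] stage_hankel[OF st, of "n j + r j + k"]
    by (simp add: \<mu>_eq add.assoc)
  have hp: "hankel_plus (S (Suc j)) k = 0 \<longleftrightarrow> hankel_plus s (\<mu> (Suc j) + k) = 0" for k
    unfolding S using hankel_two_steps(2)[OF n1 l l2, of k] stage_hankel_plus[OF st, of "n j + r j + k"]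
    by (simp add: \<mu>_eq add.assoc)
  have "i \<le> Suc j \<longleftrightarrow> \<nu> i \<le> \<mu> (Suc j)" if i: "1 \<le> i" "i \<le> N" for i
  proof
    assume "i \<le> Suc j"
    then have "\<nu> i \<le> \<nu> (Suc j)" using i j by (intro nu_mono) auto
    then show "\<nu> i \<le> \<mu> (Suc j)" by (simp add: \<mu>_eq \<nu>_eq)
  next
    assume le: "\<nu> i \<le> \<mu> (Suc j)"
    show "i \<le> Suc j"
    proof (rule ccontr)
      assume "\<not> i \<le> Suc j"
      then have gt: "\<mu> j + n j < \<nu> i"
        using nu_less_iff[of "Suc j" i] i j by (simp add: \<nu>_eq)
      define k where "k = \<nu> i - \<mu> j - n j"
      have k: "\<nu> i = \<mu> j + n j + k" "1 \<le> k" using gt by (auto simp: k_def)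
      \<comment> \<open>A further \<nu> up to the new \<mu> would give the middle sequence a nonzero
        minor of size at most \<open>r j\<close>, below its leading position
        \<open>r j + 1\<close>.\<close>
      have "hankel_plus (S j) (n j - 1 + k) \<noteq> 0"
        using nu_in(3)[OF i] k n1 by (simp add: stage_hankel_plus[OF st] add.assoc)
      then have "hankel (\<lambda>i. next_seq (n j) (S j) (i - 1)) k \<noteq> 0"
        using hankel_plus_next_seq[OF n1 l, of k] by blast
      then have "Suc (r j) \<le> k"
        using hankel_eq_0_of_leads[OF l2 k(2)] by (meson not_less)
      with le k show False by (simp add: \<mu>_eq)
    qed
  qed
  with h hp show ?thesis by (auto simp: stage_def)
qed

lemma stage: "j < N \<Longrightarrow> stage j"
  by (induction j) (auto intro: stage_0 stage_Suc)

lemma mu_less_nu: "j < N \<Longrightarrow> \<mu> j < \<nu> (Suc j)"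
  and nu_le_mu: "Suc j < N \<Longrightarrow> \<nu> (Suc j) \<le> \<mu> (Suc j)"
  and leads_n: "j < N \<Longrightarrow> leads (n j) (S j)"
  and leads_r: "Suc j < N \<Longrightarrow> leads (Suc (r j)) (\<lambda>i. next_seq (n j) (S j) (i - 1))"
  using stage_leads[OF stage] stage_leads2[OF stage] by auto

end

section \<open>Asymptotic expansions of reciprocals\<close>

text \<open>For the truncations of \<open>t\<close> and \<open>u\<close> at degree \<open>M\<close>,
  \<open>1 - Y u(X)\<close> is \<open>1 - t(X) u(X)\<close>, divisible by \<open>X^(M+1)\<close>,
  minus \<open>(Y - t(X)) u(X)\<close>, small by hypothesis. Dividing by \<open>Y\<close> preserves
  the order because \<open>Y\<close> tends to the nonzero constant term of \<open>t\<close>.\<close>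

lemma reciprocal_expansion:
  fixes t u :: "real fps" and X Y :: "'a \<Rightarrow> complex"
  assumes ut: "u * t = 1" and X: "(X \<longlongrightarrow> 0) F"
    and Y: "(\<lambda>z. Y z - (\<Sum>d\<le>M. of_real (fps_nth t d) * X z ^ d)) \<in> o[F](\<lambda>z. X z ^ M)"
  shows "(\<lambda>z. 1 / Y z - (\<Sum>d\<le>M. of_real (fps_nth u d) * X z ^ d)) \<in> o[F](\<lambda>z. X z ^ M)"
    and "eventually (\<lambda>z. Y z \<noteq> 0) F"
proof -
  define tr :: "real fps \<Rightarrow> complex poly" where
    "tr v = (\<Sum>d\<le>M. monom (of_real (fps_nth v d)) d)" for v
  have poly_tr: "poly (tr v) w = (\<Sum>d\<le>M. of_real (fps_nth v d) * w ^ d)" for v w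
    by (simp add: tr_def poly_sum poly_monom)
  have coeff_tr: "coeff (tr v) k = of_real (fps_nth v k)" if "k \<le> M" for v k
    using that by (simp add: tr_def coeff_sum)
  have lim: "((\<lambda>z. poly q (X z)) \<longlongrightarrow> poly q 0) F" for q
    by (rule isCont_tendsto_compose[OF _ X]) simp
  have O1: "f \<in> O[F](\<lambda>_. 1)" if "(f \<longlongrightarrow> c) F" for f :: "'a \<Rightarrow> complex" and c
    by (rule bigoI_tendsto[where c = c]) (use that in auto)
  have coeff_prod: "coeff (1 - tr t * tr u) k = 0" if "k < Suc M" for k
  proof -
    have "coeff (tr t * tr u) k = (\<Sum>i\<le>k. of_real (fps_nth t i) * of_real (fps_nth u (k - i)))"
      unfolding coeff_mult by (rule sum.cong) (use that in \<open>auto simp: coeff_tr\<close>)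
    also have "\<dots> = of_real (fps_nth (t * u) k)"
      by (simp add: fps_mult_nth atLeast0AtMost)
    also have "t * u = 1"
      using ut by (simp add: mult.commute)
    finally show ?thesis by (simp add: coeff_1)
  qed
  then obtain R where R: "1 - tr t * tr u = monom 1 (Suc M) * R"
    using monom_1_dvd_iff' by (metis dvdE)
  have t0: "fps_nth t 0 \<noteq> 0"
    using ut by (metis fps_mult_nth_0 fps_one_nth mult_zero_right zero_neq_one)
  have "(\<lambda>z. Y z - poly (tr t) (X z)) \<in> o[F](\<lambda>_. 1)"
    using landau_o.small_big_trans[OF Y O1[OF tendsto_power[OF X]]] by (simp add: poly_tr)
  then have "((\<lambda>z. Y z - poly (tr t) (X z)) \<longlongrightarrow> 0) F"
    using smalloD_tendsto by fastforce
  from tendsto_add[OF this lim[of "tr t"]] have Y_lim: "(Y \<longlongrightarrow> of_real (fps_nth t 0)) F"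
    by (simp add: poly_0_coeff_0 coeff_tr)
  then show ev: "eventually (\<lambda>z. Y z \<noteq> 0) F"
    by (rule tendsto_imp_eventually_ne) (use t0 in simp)
  have "((\<lambda>z. X z * poly R (X z)) \<longlongrightarrow> 0) F"
    using tendsto_mult[OF X lim[of R]] by simp
  then have "(\<lambda>z. X z * poly R (X z)) \<in> o[F](\<lambda>_. 1)"
    by (intro smalloI_tendsto) auto
  then have "(\<lambda>z. X z ^ M * (X z * poly R (X z))) \<in> o[F](\<lambda>z. X z ^ M * 1)"
    by (intro landau_o.big_small_mult) auto
  moreover have "(\<lambda>z. (Y z - poly (tr t) (X z)) * poly (tr u) (X z)) \<in> o[F](\<lambda>z. X z ^ M * 1)"
    using Y by (intro landau_o.small_big_mult O1[OF lim]) (simp add: poly_tr)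
  ultimately have "(\<lambda>z. X z ^ M * (X z * poly R (X z)) - (Y z - poly (tr t) (X z)) * poly (tr u) (X z))
      \<in> o[F](\<lambda>z. X z ^ M * 1)"
    by (rule sum_in_smallo)
  then have "(\<lambda>z. (X z ^ M * (X z * poly R (X z)) - (Y z - poly (tr t) (X z)) * poly (tr u) (X z)) * (1 / Y z))
      \<in> o[F](\<lambda>z. X z ^ M * 1 * 1)"
    using t0 by (intro landau_o.small_big_mult O1[OF tendsto_divide[OF tendsto_const Y_lim]]) auto
  moreover have "\<forall>\<^sub>F z in F. (X z ^ M * (X z * poly R (X z)) - (Y z - poly (tr t) (X z)) * poly (tr u) (X z)) * (1 / Y z)
      = 1 / Y z - (\<Sum>d\<le>M. of_real (fps_nth u d) * X z ^ d)"
    using ev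
  proof eventually_elim
    case (elim z)
    have "X z ^ M * (X z * poly R (X z)) = 1 - poly (tr t) (X z) * poly (tr u) (X z)"
      using arg_cong[OF R, of "\<lambda>q. poly q (X z)"] by (simp add: poly_monom mult_ac)
    then have "X z ^ M * (X z * poly R (X z)) - (Y z - poly (tr t) (X z)) * poly (tr u) (X z) =
        1 - Y z * poly (tr u) (X z)"
      by (simp add: algebra_simps)
    with elim show ?case
      by (simp add: poly_tr field_simps)
  qed
  ultimately show "(\<lambda>z. 1 / Y z - (\<Sum>d\<le>M. of_real (fps_nth u d) * X z ^ d)) \<in> o[F](\<lambda>z. X z ^ M)"
    by (subst (asm) landau_o.small.in_cong) auto
qed

text \<open>The factor \<open>X^a\<close> is divided out before inverting and again afterwards, so
  the precision drops from order \<open>M\<close> to order \<open>M - 2a\<close>.\<close>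

lemma reciprocal_expansion_leads:
  fixes X Y :: "'a \<Rightarrow> complex"
  assumes lead: "s (int a - 1) \<noteq> 0" and a: "a \<le> M"
    and X: "(X \<longlongrightarrow> 0) F" "eventually (\<lambda>z. X z \<noteq> 0) F"
    and Y: "(\<lambda>z. Y z - (\<Sum>d=a..M. of_real (s (int d - 1)) * X z ^ d)) \<in> o[F](\<lambda>z. X z ^ M)"
  shows "(\<lambda>z. 1 / Y z - (\<Sum>d\<le>M - a. of_real (fps_nth (inverse (lead_fps a s)) d) * X z ^ d) / X z ^ a)
      \<in> o[F](\<lambda>z. X z ^ (M - a) / X z ^ a)"
    and "eventually (\<lambda>z. Y z \<noteq> 0) F"
proof -
  let ?t = "lead_fps a s"
  have sum_eq: "(\<Sum>d=a..M. of_real (s (int d - 1)) * w ^ d) =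
      w ^ a * (\<Sum>d\<le>M - a. of_real (fps_nth ?t d) * w ^ d)" for w :: complex
    unfolding sum_distrib_left
    by (rule sum.reindex_bij_witness[of _ "\<lambda>d. d + a" "\<lambda>d. d - a"])
       (use a in \<open>auto simp: of_nat_diff power_add[symmetric] algebra_simps\<close>)
  have "(\<lambda>z. (Y z - (\<Sum>d=a..M. of_real (s (int d - 1)) * X z ^ d)) * inverse (X z ^ a))
      \<in> o[F](\<lambda>z. X z ^ M * inverse (X z ^ a))"
    by (rule landau_o.small_big_mult[OF Y]) simp
  also have "?this \<longleftrightarrow> (\<lambda>z. Y z / X z ^ a - (\<Sum>d\<le>M - a. of_real (fps_nth ?t d) * X z ^ d))
      \<in> o[F](\<lambda>z. X z ^ (M - a))"
  proof (rule landau_o.small.cong_ex)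
    show "\<forall>\<^sub>F z in F. (Y z - (\<Sum>d=a..M. of_real (s (int d - 1)) * X z ^ d)) * inverse (X z ^ a) =
        Y z / X z ^ a - (\<Sum>d\<le>M - a. of_real (fps_nth ?t d) * X z ^ d)"
      using X(2) by eventually_elim (simp only: sum_eq, simp add: field_simps)
    show "\<forall>\<^sub>F z in F. X z ^ M * inverse (X z ^ a) = X z ^ (M - a)"
      using X(2) by eventually_elim (use a in \<open>simp add: power_diff divide_inverse\<close>)
  qed
  finally have *: "(\<lambda>z. Y z / X z ^ a - (\<Sum>d\<le>M - a. of_real (fps_nth ?t d) * X z ^ d))
      \<in> o[F](\<lambda>z. X z ^ (M - a))" .
  note exp = reciprocal_expansion[OF lead_fps_inverse[of s a, OF lead] X(1) *]
  show "eventually (\<lambda>z. Y z \<noteq> 0) F"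
    using exp(2) by eventually_elim auto
  have "(\<lambda>z. (1 / (Y z / X z ^ a) - (\<Sum>d\<le>M - a. of_real (fps_nth (inverse ?t) d) * X z ^ d)) * inverse (X z ^ a))
      \<in> o[F](\<lambda>z. X z ^ (M - a) * inverse (X z ^ a))"
    by (rule landau_o.small_big_mult[OF exp(1)]) simp
  also have "?this \<longleftrightarrow> (\<lambda>z. 1 / Y z - (\<Sum>d\<le>M - a. of_real (fps_nth (inverse ?t) d) * X z ^ d) / X z ^ a)
      \<in> o[F](\<lambda>z. X z ^ (M - a) / X z ^ a)"
  proof (rule landau_o.small.cong_ex)
    show "\<forall>\<^sub>F z in F. (1 / (Y z / X z ^ a) - (\<Sum>d\<le>M - a. of_real (fps_nth (inverse ?t) d) * X z ^ d)) *
          inverse (X z ^ a) =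
        1 / Y z - (\<Sum>d\<le>M - a. of_real (fps_nth (inverse ?t) d) * X z ^ d) / X z ^ a"
      using X(2) by eventually_elim (simp add: left_diff_distrib divide_inverse)
    show "\<forall>\<^sub>F z in F. X z ^ (M - a) * inverse (X z ^ a) = X z ^ (M - a) / X z ^ a"
      by (simp add: divide_inverse)
  qed
  finally show "(\<lambda>z. 1 / Y z - (\<Sum>d\<le>M - a. of_real (fps_nth (inverse ?t) d) * X z ^ d) / X z ^ a)
      \<in> o[F](\<lambda>z. X z ^ (M - a) / X z ^ a)" .
qed

text \<open>A polynomial in \<open>1/x\<close> is its reversed coefficient list in powers of
  \<open>x\<close>. The exponent \<open>c\<close> is \<open>1\<close> for the atoms
  \<open>m\<close>, which enter the fraction multiplied by \<open>z\<close>, and \<open>0\<close>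
  for the atoms \<open>l\<close>.\<close>

lemma cpoly_inverse:
  fixes w x :: complex
  assumes "degree q < b" "x \<noteq> 0" "w = 1 / x"
    and "\<And>d. d < b \<Longrightarrow> coeff q (b - 1 - d) = u d"
  shows "cpoly q w * w ^ c = (\<Sum>d<b. of_real (u d) * x ^ d) / x ^ (b - 1 + c)"
proof -
  define q' where "q' = map_poly complex_of_real q"
  have "degree q' < b"
    using degree_map_poly[of complex_of_real q] assms(1) by (simp add: q'_def)
  then have "poly q' w = (\<Sum>k<b. coeff q' k * w ^ k)"
    unfolding poly_altdef by (intro sum.mono_neutral_left) (auto simp: coeff_eq_0)
  then have "cpoly q w = (\<Sum>k<b. of_real (coeff q k) * w ^ k)"
    by (simp add: q'_def coeff_map_poly)
  also have "\<dots> = (\<Sum>d<b. of_real (u d) * w ^ (b - 1 - d))"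
    by (rule sum.reindex_bij_witness[of _ "\<lambda>k. b - 1 - k" "\<lambda>k. b - 1 - k"])
       (auto simp flip: assms(4))
  also have "\<dots> * w ^ c = (\<Sum>d<b. of_real (u d) * x ^ d / x ^ (b - 1 + c))"
    unfolding sum_distrib_right
  proof (rule sum.cong)
    fix d assume "d \<in> {..<b}"
    then have "b - 1 + c = (b - 1 - d) + c + d" by auto
    then have "x ^ (b - 1 + c) = x ^ (b - 1 - d) * x ^ c * x ^ d"
      by (metis power_add)
    then show "of_real (u d) * w ^ (b - 1 - d) * w ^ c = of_real (u d) * x ^ d / x ^ (b - 1 + c)"
      using assms(2,3) by (simp add: power_divide)
  qed simp
  finally show ?thesis by (simp add: sum_divide_distrib)
qed

text \<open>Here \<open>Q\<close> is the polynomial part of \<open>1 / Y\<close>, without its constant term when \<open>b = a\<close>.\<close>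

lemma expansion_next_seq:
  fixes X Y :: "'a \<Rightarrow> complex"
  assumes lead: "s (int a - 1) \<noteq> 0" and a: "2 * a \<le> M" and b: "a \<le> b" "b + a \<le> M + 1"
    and X: "(X \<longlongrightarrow> 0) F" "eventually (\<lambda>z. X z \<noteq> 0) F"
    and Y: "(\<lambda>z. Y z - (\<Sum>d=a..M. of_real (s (int d - 1)) * X z ^ d)) \<in> o[F](\<lambda>z. X z ^ M)"
    and Q: "\<forall>\<^sub>F z in F. Q z = (\<Sum>d<b. of_real (fps_nth (inverse (lead_fps a s)) d) * X z ^ d) / X z ^ a"
  shows "(\<lambda>z. 1 / Y z - Q z + (\<Sum>d=b-a..M-2*a. of_real (next_seq a s (int d - 1)) * X z ^ d))
      \<in> o[F](\<lambda>z. X z ^ (M - 2 * a))"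
proof -
  define u where "u = fps_nth (inverse (lead_fps a s))"
  have "(\<lambda>z. 1 / Y z - (\<Sum>d\<le>M - a. of_real (u d) * X z ^ d) / X z ^ a)
      \<in> o[F](\<lambda>z. X z ^ (M - a) / X z ^ a)"
    using reciprocal_expansion_leads(1)[OF lead _ X Y] a by (simp add: u_def)
  also have "?this \<longleftrightarrow> ?thesis"
  proof (rule landau_o.small.cong_ex)
    show "\<forall>\<^sub>F z in F. X z ^ (M - a) / X z ^ a = X z ^ (M - 2 * a)"
      using X(2) by eventually_elim (use a in \<open>simp add: power_diff mult_2 flip: power_add\<close>)
    show "\<forall>\<^sub>F z in F. 1 / Y z - (\<Sum>d\<le>M - a. of_real (u d) * X z ^ d) / X z ^ a =
        1 / Y z - Q z + (\<Sum>d=b-a..M-2*a. of_real (next_seq a s (int d - 1)) * X z ^ d)"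
      using X(2) Q
    proof eventually_elim
      case (elim z)
      have "{..M - a} = {..<b} \<union> {b..M - a}" using b by auto
      then have "(\<Sum>d\<le>M - a. of_real (u d) * X z ^ d) =
          (\<Sum>d<b. of_real (u d) * X z ^ d) + (\<Sum>d=b..M - a. of_real (u d) * X z ^ d)"
        by (simp add: sum.union_disjoint ivl_disj_int)
      moreover have "(\<Sum>d=b..M - a. of_real (u d) * X z ^ d) / X z ^ a =
          (\<Sum>d=b..M - a. of_real (u d) * X z ^ (d - a))"
        unfolding sum_divide_distrib
        by (rule sum.cong) (use b elim(1) in \<open>auto simp: power_diff\<close>)
      moreover have "(\<Sum>d=b..M - a. of_real (u d) * X z ^ (d - a)) =
          (\<Sum>d=b-a..M-2*a. of_real (- next_seq a s (int d - 1)) * X z ^ d)"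
        by (rule sum.reindex_bij_witness[of _ "\<lambda>d. d + a" "\<lambda>d. d - a"])
           (use a b in \<open>auto simp: next_seq_def u_def of_nat_diff nat_add_distrib\<close>)
      ultimately show ?case
        using elim(2) by (simp add: add_divide_distrib sum_negf u_def)
    qed
  qed
  finally show ?thesis .
qed

section \<open>The continued fraction\<close>

text \<open>The fraction solved from the top: if \<open>g\<close> is the whole fraction beginning at
  \<open>a 1\<close>, this is the value of the part that begins at \<open>a (j+1)\<close>.\<close>

primrec cfrac_tail :: "(nat \<Rightarrow> complex) \<Rightarrow> (nat \<Rightarrow> complex) \<Rightarrow> complex \<Rightarrow> nat \<Rightarrow> complex" where
  "cfrac_tail a b g 0 = g"
| "cfrac_tail a b g (Suc j) = 1 / (1 / cfrac_tail a b g j - a (Suc j)) - b (Suc j)"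

text \<open>With \<open>1 / 0 = 0\<close> the map \<open>x \<mapsto> 1 / x\<close> is an involution of the whole plane, so that no
  denominator has to be nonzero here.\<close>

lemma cfrac_cfrac_tail:
  assumes "1 / t = 1 / cfrac_tail a b g (j + k) - a (Suc (j + k))"
  shows "cfrac a b t (Suc j) k = cfrac_tail a b g j"
  using assms
proof (induction k arbitrary: j)
  case (Suc k)
  have "cfrac a b t (Suc (Suc j)) k = cfrac_tail a b g (Suc j)"
    by (rule Suc.IH) (use Suc.prems in simp)
  then show ?case by simp
qed simp

text \<open>Each denominator of the fraction is the reciprocal of a tail or of
  \<open>1 / tail - a\<close>, so these two kinds of quantity are all that must be nonzero.\<close>

lemma cfrac_defined_cfrac_tail:
  assumes "1 / t = 1 / cfrac_tail a b g (j + k) - a (Suc (j + k))"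
    and "\<And>i. j \<le> i \<Longrightarrow> i \<le> j + k \<Longrightarrow> cfrac_tail a b g i \<noteq> 0"
    and "\<And>i. j \<le> i \<Longrightarrow> i < j + k \<Longrightarrow> 1 / cfrac_tail a b g i - a (Suc i) \<noteq> 0"
  shows "cfrac_defined a b t (Suc j) k"
  using assms
proof (induction k arbitrary: j)
  case (Suc k)
  have "cfrac a b t (Suc (Suc j)) k = cfrac_tail a b g (Suc j)"
    by (rule cfrac_cfrac_tail) (use Suc.prems in simp)
  moreover have "cfrac_defined a b t (Suc (Suc j)) k"
    by (rule Suc.IH) (use Suc.prems in auto)
  ultimately show ?case
    using Suc.prems(2)[of j] Suc.prems(3)[of j] by simp
qed simp

section \<open>Atoms and expansions along the normal indices\<close>

context normal_enum
begin

text \<open>Conversion to the numbering of the recurrence, which starts at \<open>1\<close>: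
  superscript \<open>2j + 1\<close> is \<open>S j\<close>, and \<open>2j + 2\<close> is the middle
  sequence formed from it.\<close>

definition "S_all i = (if odd i then S (i div 2) else next_seq (n (i div 2 - 1)) (S (i div 2 - 1)))"
definition "m_all j = m_poly (n (j - 1)) (S (j - 1))"
definition "l_all j = l_atom (r (j - 1)) (next_seq (n (j - 1)) (S (j - 1)))"

lemma n_pos: "j < N \<Longrightarrow> 1 \<le> n j"
  using mu_less_nu[of j] by (simp add: n_def)

lemma mu_Suc: "Suc j < N \<Longrightarrow> \<mu> (Suc j) = \<mu> j + n j + r j"
  using mu_less_nu[of j] nu_le_mu[of j] by (simp add: n_def r_def)

lemma nu_Suc: "j < N \<Longrightarrow> \<nu> (Suc j) = \<mu> j + n j"
  using mu_less_nu[of j] by (simp add: n_def)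

lemma nu_le_ell: "j < N \<Longrightarrow> 2 * (\<mu> j + n j) \<le> ell + 2"
  using nu_mono[of "Suc j" N] by (simp add: nu_Suc ell)

lemma mu_le_ell: "Suc j < N \<Longrightarrow> 2 * (\<mu> j + n j + r j) \<le> ell"
  using mu_less_nu[of "Suc j"] nu_mono[of "Suc (Suc j)" N] by (simp add: mu_Suc ell)

lemma atoms: "atoms s ell N \<nu> \<mu> S_all m_all l_all"
  unfolding atoms_def
proof (intro conjI ballI)
  show "S_all 1 i = s i" for i
    by (simp add: S_all_def)
next
  fix j assume "j \<in> {1..N}"
  then obtain i where i: "j = Suc i" "i < N" by (cases j) auto
  have "m_step (n i) (int ell - 2 * int (\<mu> i)) (S i) (m_poly (n i) (S i)) (next_seq (n i) (S i))"
    using nu_le_ell[OF i(2)] by (intro m_step_next_seq n_pos leads_n i) simp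
  then show "m_step (\<nu> j - \<mu> (j - 1)) (int ell - 2 * int (\<mu> (j - 1))) (S_all (2 * j - 1)) (m_all j) (S_all (2 * j))"
    by (simp add: i S_all_def m_all_def n_def)
next
  fix j assume "j \<in> {1..<N}"
  then obtain i where i: "j = Suc i" "Suc i < N" by (cases j) auto
  have "l_step (n i) (r i) (int ell - 2 * int (\<mu> i)) (S i) (next_seq (n i) (S i))
      (l_atom (r i) (next_seq (n i) (S i))) (next_seq (r i) (next_seq (n i) (S i)))"
    using mu_le_ell[OF i(2)] i
    by (intro l_step_next_seq n_pos leads_n leads_shift[OF leads_r]) auto
  moreover have "S_all (2 * j + 1) = next_seq (r i) (next_seq (n i) (S i))"
    by (simp add: i S_all_def n_def r_def)
  ultimately show "l_step (\<nu> j - \<mu> (j - 1)) (\<mu> j - \<nu> j) (int ell - 2 * int (\<mu> (j - 1)))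
      (S_all (2 * j - 1)) (S_all (2 * j)) (l_all j) (S_all (2 * j + 1))"
    by (simp add: i S_all_def l_all_def n_def r_def)
qed

text \<open>The order in \<open>X = 1/z\<close> to which the \<open>j\<close>-th tail is known; its
  last coefficient is the entry with index \<open>ell - 2 * \<mu> j\<close>.\<close>

definition "M j = ell + 1 - 2 * \<mu> j"

lemma M_ge: "Suc j < N \<Longrightarrow> 2 * (n j + r j) + 1 \<le> M j"
  using mu_le_ell[of j] by (simp add: M_def)

lemma M_Suc: "Suc j < N \<Longrightarrow> M (Suc j) = M j - 2 * n j - 2 * r j"
  by (simp add: M_def mu_Suc)

lemma M_last: "M (N - 1) = 2 * n (N - 1) - 1"
  unfolding M_def using nu_Suc[of "N - 1"] N n_pos[of "N - 1"] ell by simp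

lemma n_le_M:
  assumes "j < N"
  shows "n j \<le> M j"
proof (cases "Suc j < N")
  case False
  then have "j = N - 1" using assms by simp
  then show ?thesis using M_last n_pos[OF assms] by simp
qed (use M_ge[of j] in simp)

lemma sum_S_leads:
  assumes "j < N"
  shows "(\<Sum>d=1..M j. of_real (S j (int d - 1)) * x ^ d) =
    (\<Sum>d=n j..M j. of_real (S j (int d - 1)) * (x::complex) ^ d)"
  by (rule sum.mono_neutral_right)
     (use n_pos[OF assms] leadsD[OF leads_n[OF assms]] in auto)

context
  fixes \<FF> :: "'b filter" and \<zeta> X :: "'b \<Rightarrow> complex"
  assumes X: "(X \<longlongrightarrow> 0) \<FF>" "eventually (\<lambda>z. X z \<noteq> 0) \<FF>" and \<zeta>: "\<And>z. \<zeta> z = 1 / X z"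
begin

lemma m_poly_eventually:
  assumes "j < N"
  shows "\<forall>\<^sub>F z in \<FF>. cpoly (m_poly (n j) (S j)) (\<zeta> z) * \<zeta> z =
    (\<Sum>d<n j. of_real (fps_nth (inverse (lead_fps (n j) (S j))) d) * X z ^ d) / X z ^ n j"
  using X(2)
proof eventually_elim
  case (elim z)
  have "coeff (m_poly (n j) (S j)) (n j - 1 - d) = fps_nth (inverse (lead_fps (n j) (S j))) d"
    if "d < n j" for d
    using m_poly_coeff[of "n j - 1" "S j" d] leads_n[OF assms] that by simp
  from cpoly_inverse[OF degree_m_poly[OF leads_n[OF assms] n_pos[OF assms]] elim \<zeta>[of z] this, of 1]
  show ?case using n_pos[OF assms] by simp
qed

lemma l_atom_eventually:
  assumes "leads q s'"
  shows "\<forall>\<^sub>F z in \<FF>. cpoly (l_atom q s') (\<zeta> z) =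
    (\<Sum>d<q + 1. of_real (fps_nth (inverse (lead_fps q s')) d) * X z ^ d) / X z ^ q"
  using X(2)
proof eventually_elim
  case (elim z)
  have "coeff (l_atom q s') (q + 1 - 1 - d) = fps_nth (inverse (lead_fps q s')) d"
    if "d < q + 1" for d
    using l_atom_coeff[OF assms, of d] that by simp
  from cpoly_inverse[OF _ elim \<zeta>[of z] this, of 0] degree_l_atom[of q s']
  show ?case by simp
qed

context
  fixes j :: nat and G :: "'b \<Rightarrow> complex"
  assumes j: "j < N"
    and G: "(\<lambda>z. G z + (\<Sum>d=1..M j. of_real (S j (int d - 1)) * X z ^ d)) \<in> o[\<FF>](\<lambda>z. X z ^ M j)"
begin

lemma neg_G: "(\<lambda>z. - G z - (\<Sum>d=n j..M j. of_real (S j (int d - 1)) * X z ^ d)) \<in> o[\<FF>](\<lambda>z. X z ^ M j)"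
proof -
  have "(\<lambda>z. - (G z + (\<Sum>d=1..M j. of_real (S j (int d - 1)) * X z ^ d))) \<in> o[\<FF>](\<lambda>z. X z ^ M j)"
    using G by (simp only: landau_o.small.uminus_in_iff)
  then show ?thesis
    unfolding sum_S_leads[OF j] by (simp add: algebra_simps)
qed

lemma lead_nz: "S j (int (n j) - 1) \<noteq> 0"
  using leads_n[OF j] by (simp add: leads_def)

lemma G_nz: "eventually (\<lambda>z. G z \<noteq> 0) \<FF>"
  using reciprocal_expansion_leads(2)[OF lead_nz n_le_M[OF j] X neg_G] by simp

text \<open>The choice of \<open>ell\<close> leaves order \<open>2n - 1\<close> before the last
  step. The reciprocal is then known through \<open>X^(-1)\<close>, which is exactly the polynomial
  \<open>m z\<close>, with error \<open>o(z)\<close>.\<close>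

lemma last_expansion:
  assumes "Suc j = N"
  shows "(\<lambda>z. 1 / G z + cpoly (m_poly (n j) (S j)) (\<zeta> z) * \<zeta> z) \<in> o[\<FF>](\<zeta>)"
proof -
  have Mj: "M j - n j = n j - 1" "{..n j - 1} = {..<n j}"
    using M_last n_pos[OF j] assms by auto
  have "(\<lambda>z. 1 / - G z - (\<Sum>d<n j. of_real (fps_nth (inverse (lead_fps (n j) (S j))) d) * X z ^ d) / X z ^ n j)
      \<in> o[\<FF>](\<lambda>z. X z ^ (n j - 1) / X z ^ n j)"
    using reciprocal_expansion_leads(1)[OF lead_nz n_le_M[OF j] X neg_G] unfolding Mj .
  also have "?this \<longleftrightarrow> (\<lambda>z. - (1 / G z + cpoly (m_poly (n j) (S j)) (\<zeta> z) * \<zeta> z)) \<in> o[\<FF>](\<zeta>)"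
  proof (rule landau_o.small.cong_ex)
    show "\<forall>\<^sub>F z in \<FF>. X z ^ (n j - 1) / X z ^ n j = \<zeta> z"
      using X(2) by eventually_elim (use n_pos[OF j] in \<open>simp add: \<zeta> power_diff\<close>)
    show "\<forall>\<^sub>F z in \<FF>. 1 / - G z -
        (\<Sum>d<n j. of_real (fps_nth (inverse (lead_fps (n j) (S j))) d) * X z ^ d) / X z ^ n j =
        - (1 / G z + cpoly (m_poly (n j) (S j)) (\<zeta> z) * \<zeta> z)"
      using m_poly_eventually[OF j] by eventually_elim simp
  qed
  finally show ?thesis
    by (simp only: landau_o.small.uminus_in_iff)
qed

text \<open>One level of the fraction: \<open>H\<close> remains of \<open>1/G\<close> after removing
  the powers of \<open>z\<close> from the first on, and \<open>1/H\<close> minus its polynomial part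
  again has the shape of \<open>G\<close>, with the next odd sequence.\<close>

lemma next_expansion:
  assumes Sj: "Suc j < N"
  defines "H \<equiv> \<lambda>z. 1 / G z + cpoly (m_poly (n j) (S j)) (\<zeta> z) * \<zeta> z"
  shows "eventually (\<lambda>z. H z \<noteq> 0) \<FF>"
    and "(\<lambda>z. 1 / H z - cpoly (l_atom (r j) (next_seq (n j) (S j))) (\<zeta> z) +
      (\<Sum>d=1..M (Suc j). of_real (S (Suc j) (int d - 1)) * X z ^ d)) \<in> o[\<FF>](\<lambda>z. X z ^ M (Suc j))"
proof -
  define s' where "s' = next_seq (n j) (S j)"
  define M' where "M' = M j - 2 * n j"
  have lr: "leads (Suc (r j)) (\<lambda>i. s' (i - 1))"
    unfolding s'_def by (rule leads_r[OF Sj])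
  have lead': "s' (int (r j) - 1) \<noteq> 0"
    using leads_shift[OF lr] by (simp add: leads_def)
  have "(\<lambda>z. 1 / - G z - cpoly (m_poly (n j) (S j)) (\<zeta> z) * \<zeta> z +
      (\<Sum>d=n j-n j..M j-2*n j. of_real (next_seq (n j) (S j) (int d - 1)) * X z ^ d))
      \<in> o[\<FF>](\<lambda>z. X z ^ (M j - 2 * n j))"
    by (rule expansion_next_seq[OF lead_nz _ _ _ X neg_G m_poly_eventually[OF j]])
       (use M_ge[OF Sj] in auto)
  then have "(\<lambda>z. - (H z - (\<Sum>d=0..M'. of_real (s' (int d - 1)) * X z ^ d))) \<in> o[\<FF>](\<lambda>z. X z ^ M')"
    by (simp add: H_def s'_def M'_def algebra_simps)
  then have "(\<lambda>z. H z - (\<Sum>d=0..M'. of_real (s' (int d - 1)) * X z ^ d)) \<in> o[\<FF>](\<lambda>z. X z ^ M')"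
    by (simp only: landau_o.small.uminus_in_iff)
  moreover have "(\<Sum>d=0..M'. of_real (s' (int d - 1)) * x ^ d) =
      (\<Sum>d=r j..M'. of_real (s' (int d - 1)) * x ^ d)" for x :: complex
    by (rule sum.mono_neutral_right) (use leadsD[OF lr, of "int _"] in auto)
  ultimately have H: "(\<lambda>z. H z - (\<Sum>d=r j..M'. of_real (s' (int d - 1)) * X z ^ d)) \<in> o[\<FF>](\<lambda>z. X z ^ M')"
    by simp
  show "eventually (\<lambda>z. H z \<noteq> 0) \<FF>"
    by (rule reciprocal_expansion_leads(2)[OF lead' _ X H]) (use M_ge[OF Sj] in \<open>simp add: M'_def\<close>)
  \<comment> \<open>Now the constant term belongs to the atom, so the split is at
    \<open>b = r j + 1\<close> and the remaining sum starts at \<open>d = 1\<close>.\<close>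
  have "(\<lambda>z. 1 / H z - cpoly (l_atom (r j) s') (\<zeta> z) +
      (\<Sum>d=r j+1-r j..M'-2*r j. of_real (next_seq (r j) s' (int d - 1)) * X z ^ d))
      \<in> o[\<FF>](\<lambda>z. X z ^ (M' - 2 * r j))"
    by (rule expansion_next_seq[OF lead' _ _ _ X H l_atom_eventually[OF leads_shift[OF lr]]])
       (use M_ge[OF Sj] in \<open>auto simp: M'_def\<close>)
  moreover have "next_seq (r j) s' = S (Suc j)"
    by (simp add: s'_def n_def r_def)
  ultimately show "(\<lambda>z. 1 / H z - cpoly (l_atom (r j) (next_seq (n j) (S j))) (\<zeta> z) +
      (\<Sum>d=1..M (Suc j). of_real (S (Suc j) (int d - 1)) * X z ^ d)) \<in> o[\<FF>](\<lambda>z. X z ^ M (Suc j))"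
    by (simp add: M_Suc[OF Sj] M'_def s'_def)
qed

end

context
  fixes G :: "'b \<Rightarrow> complex" and a b :: "'b \<Rightarrow> nat \<Rightarrow> complex"
  assumes G: "(\<lambda>z. G z + (\<Sum>d=1..ell+1. of_real (s (int d - 1)) * X z ^ d)) \<in> o[\<FF>](\<lambda>z. X z ^ (ell + 1))"
    and a: "\<And>z j. a z j = - cpoly (m_all j) (\<zeta> z) * \<zeta> z"
    and b: "\<And>z j. b z j = cpoly (l_all j) (\<zeta> z)"
begin

lemma cfrac_tail_expansion:
  assumes "j < N"
  shows "(\<lambda>z. cfrac_tail (a z) (b z) (G z) j + (\<Sum>d=1..M j. of_real (S j (int d - 1)) * X z ^ d))
    \<in> o[\<FF>](\<lambda>z. X z ^ M j)"
  using assms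
proof (induction j)
  case 0
  then show ?case using G by (simp add: M_def \<mu>_0)
next
  case (Suc j)
  from next_expansion(2)[OF _ Suc.IH Suc.prems] Suc.prems show ?case
    by (simp add: a b m_all_def l_all_def)
qed

lemma eventually_cfrac_defined:
  assumes \<tau>: "\<And>z. 1 / \<tau> z = 1 / cfrac_tail (a z) (b z) (G z) (N - 1) - a z N"
  shows "eventually (\<lambda>z. cfrac_defined (a z) (b z) (\<tau> z) 1 (N - 1)) \<FF>"
proof -
  have "\<forall>\<^sub>F z in \<FF>. \<forall>j\<in>{..<N}. cfrac_tail (a z) (b z) (G z) j \<noteq> 0"
    by (intro eventually_ball_finite ballI) (auto intro!: G_nz cfrac_tail_expansion)
  moreover have "\<forall>\<^sub>F z in \<FF>. \<forall>j\<in>{..<N-1}. 1 / cfrac_tail (a z) (b z) (G z) j - a z (Suc j) \<noteq> 0"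
  proof (intro eventually_ball_finite ballI)
    fix j assume "j \<in> {..<N-1}"
    then have j: "j < N" "Suc j < N" by auto
    from next_expansion(1)[OF j(1) cfrac_tail_expansion[OF j(1)] j(2)]
    show "\<forall>\<^sub>F z in \<FF>. 1 / cfrac_tail (a z) (b z) (G z) j - a z (Suc j) \<noteq> 0"
      by (simp add: a m_all_def)
  qed simp
  ultimately show ?thesis
  proof eventually_elim
    case (elim z)
    have "cfrac_defined (a z) (b z) (\<tau> z) (Suc 0) (N - 1)"
      by (rule cfrac_defined_cfrac_tail[where g = "G z"]) (use elim \<tau>[of z] N in auto)
    then show ?case by simp
  qed
qed

lemma parameter_smallo:
  "(\<lambda>z. 1 / cfrac_tail (a z) (b z) (G z) (N - 1) - a z N) \<in> o[\<FF>](\<zeta>)"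
  using last_expansion[OF _ cfrac_tail_expansion, of "N - 1"] N by (simp add: a m_all_def)

end

end

end

section \<open>From several variables to the product variable\<close>

lemma filterlim_at_infinity_sector:
  "filterlim (\<lambda>z::complex ^ 'n::finite. z $ i) at_infinity (at_infinity_sector \<epsilon>)"
proof -
  have "at_infinity_sector \<epsilon> \<le> filtercomap (\<lambda>z::complex ^ 'n. z $ i) at_infinity"
    unfolding at_infinity_sector_def
    by (rule order_trans[OF INF_lower[of i]]) (auto intro: filtercomap_mono)
  then show ?thesis
    by (simp add: filterlim_iff_le_filtercomap)
qed

lemma eventually_at_infinity_sector_nz:
  "\<forall>\<^sub>F z::complex ^ 'n::finite in at_infinity_sector \<epsilon>. \<forall>i. z $ i \<noteq> 0"
proof (rule eventually_all_finite)
  fix i :: 'n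
  have "\<forall>\<^sub>F w::complex in at_infinity. w \<noteq> 0"
    by (auto simp: eventually_at_infinity intro!: exI[of _ 1])
  then show "\<forall>\<^sub>F z::complex ^ 'n in at_infinity_sector \<epsilon>. z $ i \<noteq> 0"
    by (rule eventually_compose_filterlim[OF _ filterlim_at_infinity_sector])
qed

lemma inverse_zprod_tendsto_0:
  "((\<lambda>z::complex ^ 'n::finite. 1 / zprod z) \<longlongrightarrow> 0) (at_infinity_sector \<epsilon>)"
proof -
  have "((\<lambda>z::complex ^ 'n. \<Prod>i\<in>UNIV. inverse (z $ i)) \<longlongrightarrow> (\<Prod>i\<in>(UNIV :: 'n set). 0))
      (at_infinity_sector \<epsilon>)"
    by (intro tendsto_prod filterlim_compose[OF tendsto_inverse_0 filterlim_at_infinity_sector])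
  then show ?thesis
    by (simp add: prod_inversef[unfolded o_def] divide_inverse power_0_left)
qed

text \<open>Multiplying by the monomial, eventually nonzero, removes the prefactor;
  \<open>d = j + 1\<close> then numbers the terms by their power of \<open>1/z\<close>.\<close>

lemma MP_solution_expansion:
  fixes p :: "nat ^ 'n::finite"
  assumes "MP_solution p s ell F" "\<epsilon> > 0"
    and assoc: "\<And>j. \<ss> (int j) = assoc_seq p s j"
  shows "(\<lambda>z. F z * zmonom p z + (\<Sum>d=1..ell+1. of_real (\<ss> (int d - 1)) * (1 / zprod z) ^ d))
    \<in> o[at_infinity_sector \<epsilon>](\<lambda>z. (1 / zprod z) ^ (ell + 1))"
proof -
  have sum_eq: "(\<Sum>j\<le>ell. complex_of_real (assoc_seq p s j) / w ^ (j + 1)) =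
      (\<Sum>d=1..ell+1. of_real (\<ss> (int d - 1)) * (1 / w) ^ d)" for w
    by (rule sum.reindex_bij_witness[of _ "\<lambda>d. d - 1" Suc])
       (auto simp: assoc[symmetric] of_nat_diff power_divide)
  have "(\<lambda>z. (F z - 1 / zmonom p z *
      (- (\<Sum>j\<le>ell. complex_of_real (assoc_seq p s j) / zprod z ^ (j + 1)))) * zmonom p z)
      \<in> o[at_infinity_sector \<epsilon>](\<lambda>z. 1 / zmonom p z * (1 / zprod z ^ (ell + 1)) * zmonom p z)"
    using assms(1,2) unfolding MP_solution_def by (intro landau_o.small_big_mult) auto
  also have "?this \<longleftrightarrow> ?thesis"
  proof (rule landau_o.small.cong_ex)
    show "\<forall>\<^sub>F z in at_infinity_sector \<epsilon>. (F z - 1 / zmonom p z *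
        (- (\<Sum>j\<le>ell. complex_of_real (assoc_seq p s j) / zprod z ^ (j + 1)))) * zmonom p z =
        F z * zmonom p z + (\<Sum>d=1..ell+1. of_real (\<ss> (int d - 1)) * (1 / zprod z) ^ d)"
      using eventually_at_infinity_sector_nz
    proof eventually_elim
      case (elim z)
      have "(F z - 1 / c * (- T)) * c = F z * c + T" if "c \<noteq> 0" for c T
        using that by (simp add: field_simps)
      from this[of "zmonom p z"] elim show ?case
        unfolding sum_eq by (simp only: prod_zero_iff finite power_eq_0_iff) blast
    qed
    show "\<forall>\<^sub>F z in at_infinity_sector \<epsilon>.
        1 / zmonom p z * (1 / zprod z ^ (ell + 1)) * zmonom p z = (1 / zprod z) ^ (ell + 1)"
      using eventually_at_infinity_sector_nz
      by eventually_elim (simp add: power_divide prod_zero_iff)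
  qed
  finally show ?thesis .
qed

theorem proposition3p3:
  fixes p :: "nat ^ 'n::finite"
    and s :: "nat ^ 'n \<Rightarrow> real"
    and \<ss> :: "int \<Rightarrow> real"
    and N ell :: nat
    and \<nu> \<mu> :: "nat \<Rightarrow> nat"
    and F :: "complex ^ 'n \<Rightarrow> complex"
  assumes p_zero: "\<exists>k. p $ k = 0"
    and diagonal: "\<And>i. (\<nexists>j. i = diag_index p j) \<Longrightarrow> s i = 0"
    and assoc: "\<And>j. \<ss> (int j) = assoc_seq p s j"
    and N: "1 \<le> N"
    and ell: "ell = 2 * \<nu> N - 2"
    and normal: "normal_indices \<ss> ell = \<nu> ` {1..N} \<union> \<mu> ` {1..<N}"
    and \<nu>: "strict_mono_on {1..N} \<nu>" "\<nu> ` {1..N} = nu_indices \<ss> ell"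
    and \<mu>: "strict_mono_on {1..<N} \<mu>" "\<mu> ` {1..<N} = mu_indices \<ss> ell"
    and \<mu>_0: "\<mu> 0 = 0"
    and solution: "MP_solution p s ell F"
  shows "\<exists>S m l \<tau>. atoms \<ss> ell N \<nu> \<mu> S m l \<and>
     (\<forall>z. (\<forall>i. z $ i \<noteq> 0) \<longrightarrow>
        F z = 1 / zmonom p z *
          cfrac (\<lambda>j. - cpoly (m j) (zprod z) * zprod z) (\<lambda>j. cpoly (l j) (zprod z)) (\<tau> z)
            1 (N - 1)) \<and>
     (\<forall>\<epsilon>>0. \<forall>\<^sub>F z in at_infinity_sector \<epsilon>.
        cfrac_defined (\<lambda>j. - cpoly (m j) (zprod z) * zprod z) (\<lambda>j. cpoly (l j) (zprod z)) (\<tau> z)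
          1 (N - 1)) \<and>
     (\<forall>\<epsilon>>0. (\<lambda>z. 1 / \<tau> z) \<in> o[at_infinity_sector \<epsilon>](zprod))"
proof -
  interpret normal_enum \<ss> N ell \<nu> \<mu>
    by unfold_locales fact+
  define G where "G z = F z * zmonom p z" for z
  define a where "a z j = - cpoly (m_all j) (zprod z) * zprod z" for z :: "complex ^ 'n" and j
  define b where "b z j = cpoly (l_all j) (zprod z)" for z :: "complex ^ 'n" and j
  \<comment> \<open>The fraction is solved for its parameter. Since \<open>1 / 0 = 0\<close>, the
    identity for \<open>1 / \<tau> z\<close> also holds where the bracket vanishes, that is, where
    the parameter is infinite.\<close>
  define \<tau> where "\<tau> z = 1 / (1 / cfrac_tail (a z) (b z) (G z) (N - 1) - a z N)" for z
  have \<tau>: "1 / \<tau> z = 1 / cfrac_tail (a z) (b z) (G z) (N - 1) - a z N" for z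
    by (simp add: \<tau>_def)
  have X: "((\<lambda>z::complex ^ 'n. 1 / zprod z) \<longlongrightarrow> 0) (at_infinity_sector \<epsilon>)"
    "\<forall>\<^sub>F z::complex ^ 'n in at_infinity_sector \<epsilon>. 1 / zprod z \<noteq> 0"
    "\<And>z::complex ^ 'n. zprod z = 1 / (1 / zprod z)" for \<epsilon>
    using inverse_zprod_tendsto_0 eventually_at_infinity_sector_nz[of \<epsilon>]
    by (auto elim: eventually_mono)
  have exp: "(\<lambda>z. G z + (\<Sum>d=1..ell+1. of_real (\<ss> (int d - 1)) * (1 / zprod z) ^ d))
      \<in> o[at_infinity_sector \<epsilon>](\<lambda>z. (1 / zprod z) ^ (ell + 1))" if "\<epsilon> > 0" for \<epsilon>
    unfolding G_def by (rule MP_solution_expansion[OF solution that assoc])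
  have "F z = 1 / zmonom p z * cfrac (a z) (b z) (\<tau> z) 1 (N - 1)" if "\<forall>i. z $ i \<noteq> 0" for z
  proof -
    have "cfrac (a z) (b z) (\<tau> z) (Suc 0) (N - 1) = cfrac_tail (a z) (b z) (G z) 0"
      by (rule cfrac_cfrac_tail) (use N \<tau>[of z] in simp)
    with that show ?thesis by (simp add: G_def prod_zero_iff)
  qed
  moreover have "\<forall>\<^sub>F z in at_infinity_sector \<epsilon>. cfrac_defined (a z) (b z) (\<tau> z) 1 (N - 1)" if "\<epsilon> > 0" for \<epsilon>
    by (rule eventually_cfrac_defined[OF X exp[OF that] a_def b_def \<tau>])
  moreover have "(\<lambda>z. 1 / \<tau> z) \<in> o[at_infinity_sector \<epsilon>](zprod)" if "\<epsilon> > 0" for \<epsilon>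
    unfolding \<tau> by (rule parameter_smallo[OF X exp[OF that] a_def b_def])
  ultimately show ?thesis
    using atoms unfolding a_def b_def
    by (intro exI[of _ S_all] exI[of _ m_all] exI[of _ l_all] exI[of _ \<tau>]) blast
qed

end
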